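(* Let $n\ge 1$ be a natural number, let $X_1, X_2, \dots, X_n$ be pseudocompact Tychonoff spaces, and let $\Phi: \prod_{i=1}^n X_i \to \mathbb{R}$ be a continuous function (with respect to the product topology). Then $\Phi$ extends to a separately continuous function $\hat\Phi: \prod_{i=1}^n \beta X_i \to \mathbb{R}$.
   Context: All spaces are assumed to be Tychonoff. $\beta X$ denotes the Stone–Čech compactification of $X$, with $X$ regarded as a dense subspace of $\beta X$. A Tychonoff space is pseudocompact if every continuous real-valued function on it is bounded. A function on a product of spaces is separately continuous if it is continuous in each variable when all other variables are fixed. "Extends" means that the restriction of $\hat\Phi$ to $\prod_{i=1}^n X_i\subset\prod_{i=1}^n\beta X_i$ equals $\Phi$. *)

theory Defs
  imports "HOL-Analysis.Analysis"
begin

definition tychonoff_space :: "'a topology \<Rightarrow> bool" where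
  "tychonoff_space X \<longleftrightarrow> completely_regular_space X \<and> Hausdorff_space X"

definition pseudocompact_space :: "'a topology \<Rightarrow> bool" where
  "pseudocompact_space X \<longleftrightarrow>
     (\<forall>f :: 'a \<Rightarrow> real. continuous_map X euclideanreal f \<longrightarrow> bounded (f ` topspace X))"


subsection \<open>The Stone--Cech compactification\<close>

text \<open>The compactification is the closure of the canonical image of the space in the cube
  indexed by all its continuous functions into the unit interval.  HOL functions are total,
  so these functions are made extensional in order that each of them occurs exactly once
  as a coordinate.\<close>

definition unit_functions :: "'a topology \<Rightarrow> ('a \<Rightarrow> real) set" where
  "unit_functions X =
     {f \<in> extensional (topspace X). continuous_map X (top_of_set {0..1}) f}"

definition unit_cube :: "'a topology \<Rightarrow> (('a \<Rightarrow> real) \<Rightarrow> real) topology" where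
  "unit_cube X = product_topology (\<lambda>_. top_of_set {0..1}) (unit_functions X)"

definition stone_cech_embed :: "'a topology \<Rightarrow> 'a \<Rightarrow> ('a \<Rightarrow> real) \<Rightarrow> real" where
  "stone_cech_embed X x = (\<lambda>f\<in>unit_functions X. f x)"

definition stone_cech :: "'a topology \<Rightarrow> (('a \<Rightarrow> real) \<Rightarrow> real) topology" where
  "stone_cech X =
     subtopology (unit_cube X) (unit_cube X closure_of (stone_cech_embed X ` topspace X))"

text \<open>The lemmas below confirm that, for a Tychonoff space, this is a Hausdorff compactification
  with the universal property that characterises the Stone--Cech compactification.\<close>

lemma compact_space_unit_cube: "compact_space (unit_cube X)"
  unfolding unit_cube_def
  using compact_space_product_topology compact_space_subtopology compactin_euclidean_iff by blast

lemma Hausdorff_space_unit_cube: "Hausdorff_space (unit_cube X)"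
  unfolding unit_cube_def
  using Hausdorff_space_euclidean Hausdorff_space_product_topology Hausdorff_space_subtopology
  by blast

lemma compact_space_stone_cech: "compact_space (stone_cech X)"
  unfolding stone_cech_def
  by (simp add: closedin_compact_space compact_space_subtopology compact_space_unit_cube)

lemma Hausdorff_space_stone_cech: "Hausdorff_space (stone_cech X)"
  unfolding stone_cech_def
  by (simp add: Hausdorff_space_subtopology Hausdorff_space_unit_cube)

lemma unit_functions_eq:
  "unit_functions X = mspace (submetric (cfunspace X euclidean_metric) {f. f \<in> topspace X \<rightarrow> {0..1}})"
proof -
  have "bounded (f ` topspace X)" if "f \<in> topspace X \<rightarrow> {0..1}" for f :: "'a \<Rightarrow> real"
    using that by (intro bounded_subset [OF bounded_closed_interval [of 0 1]]) auto
  then show ?thesis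
    by (auto simp: unit_functions_def continuous_map_in_subtopology Pi_iff image_subset_iff)
qed

lemma embedding_map_unit_cube:
  assumes "tychonoff_space X"
  shows "embedding_map X (unit_cube X) (stone_cech_embed X)"
proof -
  have "stone_cech_embed X = (\<lambda>x. \<lambda>f\<in>unit_functions X. f x)"
    by (simp add: stone_cech_embed_def fun_eq_iff)
  then show ?thesis
    using completely_regular_space_cube_embedding_explicit [of X] assms
    by (simp only: tychonoff_space_def unit_cube_def unit_functions_eq)
qed

lemma stone_cech_embed_in_cube:
  "x \<in> topspace X \<Longrightarrow> stone_cech_embed X x \<in> topspace (unit_cube X)"
  by (auto simp: stone_cech_embed_def unit_cube_def unit_functions_def continuous_map_def)

lemma topspace_stone_cech:
  "topspace (stone_cech X) = unit_cube X closure_of (stone_cech_embed X ` topspace X)"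
  unfolding stone_cech_def by (simp add: closure_of_subset_topspace inf.absorb2)

lemma image_subset_closure:
  "stone_cech_embed X ` topspace X \<subseteq> unit_cube X closure_of (stone_cech_embed X ` topspace X)"
  by (intro closure_of_subset) (auto simp: stone_cech_embed_in_cube)

lemma embedding_map_stone_cech:
  assumes "tychonoff_space X"
  shows "embedding_map X (stone_cech X) (stone_cech_embed X)"
  using embedding_map_unit_cube [OF assms] image_subset_closure [of X]
  by (simp add: stone_cech_def embedding_map_in_subtopology image_subset_iff_funcset)

lemma dense_stone_cech_embed:
  "stone_cech X closure_of (stone_cech_embed X ` topspace X) = topspace (stone_cech X)"
  using image_subset_closure [of X]
  unfolding topspace_stone_cech
  by (simp add: stone_cech_def closure_of_subtopology inf.absorb2)

lemma stone_cech_extension: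
  fixes X :: "'a topology" and K :: "'b topology"
  assumes "compact_space K" "Hausdorff_space K" and h: "continuous_map X K h"
  shows "\<exists>H. continuous_map (stone_cech X) K H \<and>
             (\<forall>x \<in> topspace X. H (stone_cech_embed X x) = h x)"
proof -
  let ?eX = "stone_cech_embed X" and ?eK = "stone_cech_embed K"
  have "tychonoff_space K"
    using assms compact_Hausdorff_or_regular_imp_normal_space normal_imp_completely_regular_space
    unfolding tychonoff_space_def by blast
  then have "homeomorphic_map K (subtopology (unit_cube K) (?eK ` topspace K)) ?eK"
    using embedding_map_unit_cube unfolding embedding_map_def by blast
  then obtain r where hom: "homeomorphic_maps K (subtopology (unit_cube K) (?eK ` topspace K)) ?eK r"
    by (auto simp: homeomorphic_map_maps)
  define F where "F p = (\<lambda>g\<in>unit_functions K. p (restrict (g \<circ> h) (topspace X)))"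
    for p :: "('a \<Rightarrow> real) \<Rightarrow> real"
  have pull: "restrict (g \<circ> h) (topspace X) \<in> unit_functions X" if "g \<in> unit_functions K" for g
  proof -
    have "continuous_map X (top_of_set {0..1}) (g \<circ> h)"
      using that h continuous_map_compose unfolding unit_functions_def by blast
    then have "continuous_map X (top_of_set {0..1}) (restrict (g \<circ> h) (topspace X))"
      by (rule continuous_map_eq) simp
    then show ?thesis
      unfolding unit_functions_def by simp
  qed
  have contF: "continuous_map (unit_cube X) (unit_cube K) F"
    unfolding unit_cube_def
  proof (subst continuous_map_componentwise, intro conjI ballI)
    show "F ` topspace (product_topology (\<lambda>_. top_of_set {0..1}) (unit_functions X))
            \<subseteq> extensional (unit_functions K)"
      by (auto simp: F_def)
    fix g assume g: "g \<in> unit_functions K"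
    then show "continuous_map (product_topology (\<lambda>_. top_of_set {0..1}) (unit_functions X))
                 (top_of_set {0..1}) (\<lambda>p. F p g)"
      using continuous_map_product_projection [OF pull [OF g], of "\<lambda>_. top_of_set {0..1}"]
      by (simp add: F_def)
  qed
  have FeX: "F (?eX x) = ?eK (h x)" if "x \<in> topspace X" for x
    using that pull by (auto simp: F_def stone_cech_embed_def fun_eq_iff)
  have "compactin (unit_cube K) (?eK ` topspace K)"
    by (metis \<open>compact_space K\<close> compact_space_def continuous_map_in_subtopology
        hom homeomorphic_maps_def image_compactin)
  then have closed: "closedin (unit_cube K) (?eK ` topspace K)"
    by (intro compactin_imp_closedin Hausdorff_space_unit_cube)
  have "F ` topspace (stone_cech X) \<subseteq> unit_cube K closure_of (F ` ?eX ` topspace X)"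
    using contF unfolding topspace_stone_cech by (rule continuous_map_image_closure_subset)
  also have "\<dots> \<subseteq> unit_cube K closure_of (?eK ` topspace K)"
  proof (intro closure_of_mono)
    show "F ` ?eX ` topspace X \<subseteq> ?eK ` topspace K"
      using h by (auto simp: FeX continuous_map_def)
  qed
  also have "\<dots> = ?eK ` topspace K"
    by (simp add: closed closure_of_closedin)
  finally have "continuous_map (stone_cech X) (subtopology (unit_cube K) (?eK ` topspace K)) F"
    using contF unfolding continuous_map_in_subtopology
    by (auto simp: stone_cech_def continuous_map_from_subtopology)
  then have "continuous_map (stone_cech X) K (r \<circ> F)"
    using hom continuous_map_compose unfolding homeomorphic_maps_def by blast
  moreover have "(r \<circ> F) (?eX x) = h x" if "x \<in> topspace X" for x
    using that h hom by (auto simp: FeX homeomorphic_maps_def continuous_map_def)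
  ultimately show ?thesis
    by blast
qed


subsection \<open>Separate continuity\<close>

text \<open>Points of the product are the extensional families, as in
  \<^const>\<open>product_topology\<close>.\<close>

definition separately_continuous ::
    "'i set \<Rightarrow> ('i \<Rightarrow> 'b topology) \<Rightarrow> (('i \<Rightarrow> 'b) \<Rightarrow> real) \<Rightarrow> bool" where
  "separately_continuous I Y F \<longleftrightarrow>
     (\<forall>x \<in> (\<Pi>\<^sub>E i\<in>I. topspace (Y i)). \<forall>i\<in>I.
        continuous_map (Y i) euclideanreal (\<lambda>t. F (x(i := t))))"

end

theory Submission
  imports Defs
begin

text \<open>The extension at a family \<open>k\<close> of points of the \<open>\<beta>X\<^sub>i\<close> is the iterated limit of \<open>\<Phi>\<close>, where
  the coordinate \<open>x\<^sub>1\<close> tends to \<open>k\<^sub>1\<close> first, then \<open>x\<^sub>2\<close> to \<open>k\<^sub>2\<close>, and so on.  The point is that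
  the intermediate functions, in which the first \<open>m\<close> limits have been taken, stay separately continuous
  in the remaining coordinates.  They are not jointly continuous, but they retain a quasicontinuity:
  near a given point there is a nonempty open box on which the function is close to its value there, and
  one chosen side of the box may be required to contain the coordinate of the point.
  If this fails after one more limit, along \<open>X\<^sub>q\<close>, with \<open>j\<close> the chosen coordinate, one constructs
  open sets \<open>W\<^sub>k\<close> in \<open>X\<^sub>q\<close>, points \<open>z\<^sub>k\<close> in \<open>X\<^sub>j\<close> with shrinking neighbourhoods of \<open>a\<^sub>j\<close>, and
  shrinking boxes in the other coordinates such that the previous function is small on \<open>W\<^sub>k\<close> at
  \<open>z\<^sub>i\<close> for \<open>i \<le> k\<close> and large on \<open>W\<^sub>k\<close> near \<open>a\<^sub>j\<close>, where all later \<open>z\<^sub>i\<close> lie.  By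
  pseudocompactness the boxes have a common point, and fixing it leaves a separately continuous function
  of two variables, for which cluster points of the open sets give a contradiction.  Continuity of the
  full extension in each \<open>k\<^sub>i\<close> follows from a similar argument on a product of a compact and a
  pseudocompact space.\<close>

subsection \<open>Cluster points of sequences of open sets\<close>

lemma openin_continuous_map_real_gt:
  fixes f :: "'a \<Rightarrow> real"
  shows "continuous_map X euclideanreal f \<Longrightarrow> openin X {x \<in> topspace X. f x > a}"
  by (simp add: continuous_map_upper_lower_semicontinuous_lt)

lemma openin_continuous_map_real_lt:
  fixes f :: "'a \<Rightarrow> real"
  shows "continuous_map X euclideanreal f \<Longrightarrow> openin X {x \<in> topspace X. f x < a}"
  by (simp add: continuous_map_upper_lower_semicontinuous_lt)

text \<open>Absence of such points means exactly that the sequence is locally finite as an indexed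
  family. For singletons these are the cluster points of a sequence of points.\<close>

definition cluster_point_of_sets :: "'a topology \<Rightarrow> (nat \<Rightarrow> 'a set) \<Rightarrow> 'a \<Rightarrow> bool" where
  "cluster_point_of_sets X W x \<longleftrightarrow>
     x \<in> topspace X \<and> (\<forall>N k. openin X N \<and> x \<in> N \<longrightarrow> (\<exists>i\<ge>k. N \<inter> W i \<noteq> {}))"

lemma cluster_point_of_sets_le:
  fixes h :: "'a \<Rightarrow> real"
  assumes "cluster_point_of_sets X W x" "continuous_map X euclideanreal h"
    and le: "\<And>i y. i \<ge> k \<Longrightarrow> y \<in> W i \<Longrightarrow> h y \<le> c"
  shows "h x \<le> c"
proof (rule ccontr)
  assume "\<not> h x \<le> c"
  moreover have "openin X {y \<in> topspace X. h y > c}"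
    using assms(2) by (simp add: continuous_map_upper_lower_semicontinuous_lt)
  ultimately obtain i where "i \<ge> k" "{y \<in> topspace X. h y > c} \<inter> W i \<noteq> {}"
    using assms(1) unfolding cluster_point_of_sets_def
    by (smt (verit, best) mem_Collect_eq)
  then show False
    using le by fastforce
qed

lemma cluster_point_of_sets_ge:
  fixes h :: "'a \<Rightarrow> real"
  assumes "cluster_point_of_sets X W x" "continuous_map X euclideanreal h"
    and "\<And>i y. i \<ge> k \<Longrightarrow> y \<in> W i \<Longrightarrow> h y \<ge> c"
  shows "h x \<ge> c"
  using cluster_point_of_sets_le [of X W x "\<lambda>y. - h y" k "-c"] assms
  by (simp add: continuous_map_minus)

lemma compact_space_cluster_point:
  assumes "compact_space K" and t: "\<And>i. t i \<in> topspace K"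
  shows "\<exists>x. cluster_point_of_sets K (\<lambda>i. {t i}) x"
proof (rule ccontr)
  assume "\<not> ?thesis"
  then have "\<forall>x\<in>topspace K. \<exists>N k. openin K N \<and> x \<in> N \<and> (\<forall>i\<ge>k. t i \<notin> N)"
    by (auto simp: cluster_point_of_sets_def)
  then obtain N k where Nk: "\<And>x. x \<in> topspace K \<Longrightarrow> openin K (N x)"
    "\<And>x. x \<in> topspace K \<Longrightarrow> x \<in> N x" "\<And>x i. x \<in> topspace K \<Longrightarrow> i \<ge> k x \<Longrightarrow> t i \<notin> N x"
    by metis
  have "topspace K \<subseteq> \<Union> (N ` topspace K)" "\<And>U. U \<in> N ` topspace K \<Longrightarrow> openin K U"
    using Nk by auto
  then obtain F where "finite F" "F \<subseteq> N ` topspace K" "topspace K \<subseteq> \<Union>F"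
    using assms(1) unfolding compact_space_alt by meson
  then obtain S where S: "finite S" "S \<subseteq> topspace K" "topspace K \<subseteq> \<Union> (N ` S)"
    by (metis finite_subset_image)
  \<comment> \<open>The sum is a convenient common bound for the finitely many thresholds
    \<open>k x\<close>.\<close>
  define j where "j = (\<Sum>x\<in>S. k x)"
  obtain x where x: "x \<in> S" "t j \<in> N x"
    using S t by blast
  have "k x \<le> j"
    unfolding j_def using S(1) x(1) by (simp add: member_le_sum)
  then show False
    using Nk(3) x S(2) by blast
qed

section \<open>Pseudocompactness in terms of open sets\<close>

lemma bump_function:
  assumes "completely_regular_space X" "openin X W" "w \<in> W"
  obtains f :: "'a \<Rightarrow> real" where "continuous_map X euclideanreal f" "f w = 1"
    "\<And>x. x \<in> topspace X \<Longrightarrow> f x \<ge> 0" "\<And>x. x \<in> topspace X - W \<Longrightarrow> f x = 0"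
proof -
  have "closedin X (topspace X - W)" "w \<in> topspace X - (topspace X - W)"
    using assms openin_subset by blast+
  then obtain f :: "'a \<Rightarrow> real" where f: "continuous_map X (top_of_set {0..1}) f" "f w = 0"
    "f ` (topspace X - W) \<subseteq> {1}"
    using assms(1) unfolding completely_regular_space_def by metis
  show thesis
  proof
    show "continuous_map X euclideanreal (\<lambda>x. 1 - f x)"
      using f(1) by (intro continuous_intros) (simp add: continuous_map_in_subtopology)
  qed (use f in \<open>auto simp: continuous_map_in_subtopology\<close>)
qed

text \<open>Otherwise bumps of height \<open>k\<close> supported in \<open>W k\<close> form a locally finite family, whose sum
  is continuous and unbounded.\<close>

lemma pseudocompact_space_cluster_point:
  assumes "completely_regular_space X" "pseudocompact_space X"
    and W: "\<And>k. openin X (W k)" "\<And>k. W k \<noteq> {}"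
  shows "\<exists>x. cluster_point_of_sets X W x"
proof (rule ccontr)
  assume "\<not> ?thesis"
  then have loc: "\<exists>N k. openin X N \<and> x \<in> N \<and> (\<forall>i\<ge>k. N \<inter> W i = {})" if "x \<in> topspace X" for x
    using that by (auto simp: cluster_point_of_sets_def)
  have "\<exists>w. \<forall>k. w k \<in> W k"
    using W(2) by (intro choice) blast
  then obtain w where w: "\<And>k. w k \<in> W k"
    by blast
  have "\<exists>f::'a\<Rightarrow>real. continuous_map X euclideanreal f \<and> f (w k) = 1 \<and>
    (\<forall>x\<in>topspace X. f x \<ge> 0) \<and> (\<forall>x \<in> topspace X - W k. f x = 0)" for k
    using bump_function [OF assms(1) W(1) w] by metis
  then obtain f :: "nat \<Rightarrow> 'a \<Rightarrow> real" where
    f: "\<And>k. continuous_map X euclideanreal (f k)" "\<And>k. f k (w k) = 1"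
      "\<And>k x. x \<in> topspace X \<Longrightarrow> f k x \<ge> 0" "\<And>k x. x \<in> topspace X - W k \<Longrightarrow> f k x = 0"
    by metis
  \<comment> \<open>A \<open>sum\<close> over an infinite index set is 0 by convention; by
    \<open>local_sum\<close> only finitely many \<open>k\<close> occur near each point, so
    \<open>g\<close> is the intended sum.\<close>
  define g where "g x = (\<Sum>k | x \<in> W k. real k * f k x)" for x
  have local_sum: "g y = (\<Sum>k<n. real k * f k y)"
    if "y \<in> N" "openin X N" "\<forall>i\<ge>n. N \<inter> W i = {}" for y N n
  proof -
    have y: "y \<in> topspace X"
      using that openin_subset by blast
    have "k < n" if "y \<in> W k" for k
      using that \<open>y \<in> N\<close> \<open>\<forall>i\<ge>n. N \<inter> W i = {}\<close> by (meson disjoint_iff not_le)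
    then have "{k. y \<in> W k} \<subseteq> {..<n}"
      by blast
    then show ?thesis
      unfolding g_def using y by (intro sum.mono_neutral_left) (auto simp: f(4))
  qed
  have "continuous_map X euclideanreal g"
    unfolding continuous_map_eq_topcontinuous_at
  proof
    fix x assume x: "x \<in> topspace X"
    then obtain N n where N: "openin X N" "x \<in> N" "\<forall>i\<ge>n. N \<inter> W i = {}"
      using loc [OF x] by blast
    let ?s = "\<lambda>y. \<Sum>k<n. real k * f k y"
    have "continuous_map X euclideanreal ?s"
      by (intro continuous_intros f) auto
    then have s: "topcontinuous_at X euclideanreal ?s x"
      using x by (simp add: continuous_map_eq_topcontinuous_at)
    show "topcontinuous_at X euclideanreal g x"
      unfolding topcontinuous_at_def
    proof (intro conjI allI impI x)
      fix V :: "real set" assume "openin euclideanreal V \<and> g x \<in> V"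
      then obtain U where "openin X U" "x \<in> U" "\<forall>y\<in>U. ?s y \<in> V"
        using s local_sum [OF N(2,1,3)] unfolding topcontinuous_at_def by metis
      then show "\<exists>U. openin X U \<and> x \<in> U \<and> (\<forall>y\<in>U. g y \<in> V)"
        using N local_sum by (intro exI [of _ "U \<inter> N"]) auto
    qed simp
  qed
  then have "bounded (g ` topspace X)"
    using assms(2) by (simp add: pseudocompact_space_def)
  then obtain B where B: "\<And>x. x \<in> topspace X \<Longrightarrow> \<bar>g x\<bar> \<le> B"
    by (auto simp: bounded_iff)
  obtain n :: nat where n: "real n > B"
    using reals_Archimedean2 by blast
  have wn: "w n \<in> topspace X"
    using W(1) w openin_subset by blast
  then obtain N m where "openin X N" "w n \<in> N" "\<forall>i\<ge>m. N \<inter> W i = {}"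
    using loc [OF wn] by blast
  then have "k < m" if "w n \<in> W k" for k
    using that by (meson disjoint_iff not_le)
  then have "{k. w n \<in> W k} \<subseteq> {..<m}"
    by blast
  then have "finite {k. w n \<in> W k}"
    using finite_subset by blast
  then have "real n * f n (w n) \<le> g (w n)"
    unfolding g_def using w wn f(3) by (intro member_le_sum) auto
  then show False
    using B [OF wn] n f(2) [of n] by simp
qed

text \<open>A cluster point of the decreasing sequence lies in the closure of every member, and each
  closure lies in the preceding member. Applied to each side of a shrinking box, this supplies the
  common point in \<open>quasicont_step\<close>.\<close>

lemma pseudocompact_space_Inter_nonempty:
  assumes "completely_regular_space X" "pseudocompact_space X"
    and W: "\<And>k. openin X (W k)" "\<And>k. W k \<noteq> {}" "\<And>k. X closure_of W (Suc k) \<subseteq> W k"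
  shows "(\<Inter>k. W k) \<noteq> {}"
proof -
  obtain x where x: "cluster_point_of_sets X W x"
    using pseudocompact_space_cluster_point assms by metis
  have "W (Suc k) \<subseteq> W k" for k
    using W by (meson closure_of_subset openin_subset order_trans)
  then have dec: "W i \<subseteq> W k" if "k \<le> i" for i k
    using that by (rule lift_Suc_antimono_le)
  have "x \<in> X closure_of W (Suc k)" for k
    unfolding in_closure_of
  proof (intro conjI allI impI)
    fix T assume "x \<in> T \<and> openin X T"
    then obtain i where "i \<ge> Suc k" "T \<inter> W i \<noteq> {}"
      using x unfolding cluster_point_of_sets_def by blast
    then show "\<exists>y. y \<in> W (Suc k) \<and> y \<in> T"
      using dec by blast
  qed (use x in \<open>simp add: cluster_point_of_sets_def\<close>)
  then show ?thesis
    using W(3) by blast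
qed

text \<open>The points \<open>z i\<close> must be thickened to open sets before they can be clustered; this is possible
  after a cluster point of the \<open>W k\<close> has been fixed.\<close>

lemma pseudocompact_no_half_graph:
  fixes F :: "'a \<Rightarrow> 'b \<Rightarrow> real"
  assumes X: "completely_regular_space X" "pseudocompact_space X"
    and Z: "completely_regular_space Z" "pseudocompact_space Z"
    and FX: "\<And>z. z \<in> topspace Z \<Longrightarrow> continuous_map X euclideanreal (\<lambda>x. F x z)"
    and FZ: "\<And>x. x \<in> topspace X \<Longrightarrow> continuous_map Z euclideanreal (F x)"
    and W: "\<And>k. openin X (W k)" "\<And>k. W k \<noteq> {}"
    and V: "\<And>k. openin Z (V k)" "\<And>k. V (Suc k) \<subseteq> V k"
    and z: "\<And>k. z k \<in> V k"
    and lo: "\<And>i k x. i \<le> k \<Longrightarrow> x \<in> W k \<Longrightarrow> F x (z i) < l"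
    and hi: "\<And>k x v. x \<in> W k \<Longrightarrow> v \<in> V (Suc k) \<Longrightarrow> F x v > h"
    and "l < h"
  shows False
proof -
  have inX: "x \<in> topspace X" if "x \<in> W k" for x k
    using that W(1) openin_subset by blast
  have inZ: "v \<in> topspace Z" if "v \<in> V k" for v k
    using that V(1) openin_subset by blast
  have dec: "V i \<subseteq> V k" if "k \<le> i" for i k
    using V(2) that by (rule lift_Suc_antimono_le)
  obtain x where x: "cluster_point_of_sets X W x"
    using pseudocompact_space_cluster_point [of X W] X W by blast
  have xX: "x \<in> topspace X"
    using x by (simp add: cluster_point_of_sets_def)
  have Fx: "F x (z i) \<le> l" for i
    using x FX [OF inZ [OF z]] by (rule cluster_point_of_sets_le [of X W _ _ i]) (use lo in force)
  \<comment> \<open>Since \<open>F x (z i) \<le> l\<close>, a level strictly above \<open>l\<close>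
    makes each \<open>C i\<close> an open set containing \<open>z i\<close>; \<open>m < h\<close>
    leaves a gap for the contradiction.\<close>
  define m where "m = (l + h) / 2"
  have m: "l < m" "m < h"
    using \<open>l < h\<close> by (auto simp: m_def)
  define C where "C i = V i \<inter> {v \<in> topspace Z. F x v < m}" for i
  have C: "openin Z (C i)" "C i \<noteq> {}" for i
  proof -
    show "openin Z (C i)"
      unfolding C_def by (intro openin_Int V openin_continuous_map_real_lt FZ xX)
    have "z i \<in> C i"
      using z inZ Fx [of i] m by (auto simp: C_def)
    then show "C i \<noteq> {}" by blast
  qed
  obtain v where v: "cluster_point_of_sets Z C v"
    using pseudocompact_space_cluster_point [of Z C] Z C by blast
  have vZ: "v \<in> topspace Z"
    using v by (simp add: cluster_point_of_sets_def)
  have "F x v \<le> m"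
    using v FZ [OF xX] by (rule cluster_point_of_sets_le [of Z C _ _ 0]) (auto simp: C_def)
  moreover have "F y v \<ge> h" if "y \<in> W k" for y k
    using v FZ [OF inX [OF that]]
  proof (rule cluster_point_of_sets_ge [of Z C _ _ "Suc k"])
    fix i u assume "i \<ge> Suc k" "u \<in> C i"
    then have "u \<in> V (Suc k)"
      using dec [of "Suc k" i] by (auto simp: C_def)
    then show "h \<le> F y u"
      using hi that less_imp_le by blast
  qed
  then have "F x v \<ge> h"
    using x FX [OF vZ] by (rule_tac cluster_point_of_sets_ge [of X W _ _ 0]) auto
  ultimately show False
    using m by simp
qed

text \<open>For pseudocompact \<open>X\<close>, the trace on \<open>X\<close> of the neighbourhood
  filter of a point of \<beta>X has this property. Iterated limits can thus be studied without
  mentioning the compactification.\<close>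

definition converging_filter :: "'a topology \<Rightarrow> 'a filter \<Rightarrow> bool" where
  "converging_filter X p \<longleftrightarrow> p \<noteq> bot \<and> eventually (\<lambda>x. x \<in> topspace X) p \<and>
     (\<forall>f :: 'a \<Rightarrow> real. continuous_map X euclideanreal f \<longrightarrow> (\<exists>l. (f \<longlongrightarrow> l) p))"

lemma converging_filter_tendsto_Lim:
  fixes f :: "'a \<Rightarrow> real"
  assumes "converging_filter X p" "continuous_map X euclideanreal f"
  shows "(f \<longlongrightarrow> Lim p f) p"
  using assms tendsto_Lim unfolding converging_filter_def by (metis trivial_limit_def)

text \<open>If the claim fails, there are \<open>t i\<close> in \<open>K\<close> and
  \<open>z k\<close> in \<open>Z\<close> with \<open>F (t i) (z k)\<close> small for
  \<open>i \<le> k\<close> and large for \<open>i > k\<close>. At a cluster point of the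
  \<open>t i\<close>, paired with a cluster point of open sets around the \<open>z k\<close>, the
  value of \<open>F\<close> would be both small and large.\<close>

lemma Lim_pos_neighbourhood:
  fixes F :: "'k \<Rightarrow> 'a \<Rightarrow> real"
  assumes K: "compact_space K"
    and Z: "completely_regular_space Z" "pseudocompact_space Z"
    and p: "converging_filter Z p"
    and FK: "\<And>z. z \<in> topspace Z \<Longrightarrow> continuous_map K euclideanreal (\<lambda>t. F t z)"
    and FZ: "\<And>t. t \<in> topspace K \<Longrightarrow> continuous_map Z euclideanreal (F t)"
    and s: "s \<in> topspace K" "Lim p (F s) > 0"
  shows "\<exists>T. openin K T \<and> s \<in> T \<and> (\<forall>t\<in>T. Lim p (F t) > 0)"
proof (rule ccontr)
  assume neg: "\<not> ?thesis"
  define c where "c = Lim p (F s)"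
  have c: "c > 0" using s by (simp add: c_def)
  have lim: "(F t \<longlongrightarrow> Lim p (F t)) p" if "t \<in> topspace K" for t
    using converging_filter_tendsto_Lim [OF p FZ [OF that]] .
  \<comment> \<open>The first component is the current neighbourhood of \<open>s\<close>; the second
    collects the points chosen so far, all with limit at most 0, whereas the limit at
    \<open>s\<close> is \<open>c\<close>.\<close>
  define inv where "inv S = (openin K (fst S) \<and> s \<in> fst S \<and> finite (snd S) \<and> snd S \<subseteq> topspace K \<and>
     (\<forall>t\<in>snd S. Lim p (F t) \<le> 0))" for S :: "'k set \<times> 'k set"
  define nxt where "nxt S S' t z \<longleftrightarrow> t \<in> fst S \<and> snd S' = insert t (snd S) \<and> fst S' \<subseteq> fst S \<and>
     z \<in> topspace Z \<and> (\<forall>u\<in>snd S'. F u z < c/4) \<and> F s z > 3*c/4 \<and> (\<forall>u\<in>fst S'. F u z > 3*c/4)"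
    for S S' :: "'k set \<times> 'k set" and t z
  have "\<exists>S. \<forall>n. inv (S n) \<and> (\<exists>t z. nxt (S n) (S (Suc n)) t z)"
  proof (rule dependent_nat_choice)
    show "\<exists>S. inv S"
      using s by (intro exI [of _ "(topspace K, {})"]) (auto simp: inv_def)
    fix S :: "'k set \<times> 'k set" and n :: nat
    assume S: "inv S"
    then obtain t where t: "t \<in> fst S" "Lim p (F t) \<le> 0"
      using neg unfolding inv_def by (metis not_le)
    have tK: "t \<in> topspace K"
      using t S openin_subset unfolding inv_def by blast
    have "\<forall>\<^sub>F z in p. F u z < c/4" if "u \<in> insert t (snd S)" for u
    proof (rule order_tendstoD(2))
      show "(F u \<longlongrightarrow> Lim p (F u)) p"
        using that S tK by (intro lim) (auto simp: inv_def)
      show "Lim p (F u) < c/4"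
        using that S t c by (force simp: inv_def)
    qed
    then have "\<forall>\<^sub>F z in p. \<forall>u\<in>insert t (snd S). F u z < c/4"
      using S by (intro eventually_ball_finite) (auto simp: inv_def)
    moreover have "\<forall>\<^sub>F z in p. F s z > 3*c/4"
      by (rule order_tendstoD(1) [OF lim [OF s(1)]]) (use c in \<open>auto simp: c_def\<close>)
    moreover have "\<forall>\<^sub>F z in p. z \<in> topspace Z"
      using p by (auto simp: converging_filter_def)
    ultimately have "\<forall>\<^sub>F z in p. (\<forall>u\<in>insert t (snd S). F u z < c/4) \<and> F s z > 3*c/4 \<and> z \<in> topspace Z"
      by (intro eventually_conj)
    moreover have "p \<noteq> bot"
      using p by (auto simp: converging_filter_def)
    ultimately obtain z where z: "\<forall>u\<in>insert t (snd S). F u z < c/4" "F s z > 3*c/4" "z \<in> topspace Z"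
      using eventually_happens' by blast
    define T where "T = fst S \<inter> {u \<in> topspace K. F u z > 3*c/4}"
    have "openin K T"
      unfolding T_def using S
      by (intro openin_Int openin_continuous_map_real_gt FK z(3)) (simp add: inv_def)
    then have "inv (T, insert t (snd S))"
      using S z s t tK by (auto simp: inv_def T_def)
    moreover have "nxt S (T, insert t (snd S)) t z"
      using z t by (auto simp: nxt_def T_def)
    ultimately show "\<exists>S'. inv S' \<and> (\<exists>t z. nxt S S' t z)"
      by blast
  qed
  then obtain S t z where S: "\<And>n. inv (S n)" "\<And>n. nxt (S n) (S (Suc n)) (t n) (z n)"
    by metis
  have snd_mono: "snd (S i) \<subseteq> snd (S k)" if "i \<le> k" for i k
    by (rule lift_Suc_mono_le [of "\<lambda>n. snd (S n)", OF _ that]) (use S(2) in \<open>auto simp: nxt_def\<close>)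
  have fst_mono: "fst (S k) \<subseteq> fst (S i)" if "i \<le> k" for i k
    by (rule lift_Suc_antimono_le [of "\<lambda>n. fst (S n)", OF _ that]) (use S(2) in \<open>auto simp: nxt_def\<close>)
  have zZ: "z n \<in> topspace Z" for n
    using S(2) by (simp add: nxt_def)
  have tK: "t n \<in> topspace K" for n
    using S openin_subset unfolding inv_def nxt_def by blast
  have lo: "F (t i) (z k) < c/4" if "i \<le> k" for i k
  proof -
    have "t i \<in> snd (S (Suc k))"
      using snd_mono [of "Suc i" "Suc k"] that S(2) [of i] by (auto simp: nxt_def)
    then show ?thesis
      using S(2) [of k] by (auto simp: nxt_def)
  qed
  have hi: "F (t i) (z k) > 3*c/4" if "k < i" for i k
    using fst_mono [of "Suc k" i] that S(2) [of k] S(2) [of i] by (auto simp: nxt_def)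
  obtain u where u: "cluster_point_of_sets K (\<lambda>i. {t i}) u"
    using compact_space_cluster_point [OF K] tK by blast
  have uK: "u \<in> topspace K"
    using u by (simp add: cluster_point_of_sets_def)
  have Fu: "F u (z k) \<ge> 3*c/4" for k
    using u FK [OF zZ]
    by (rule cluster_point_of_sets_ge [of K _ _ _ "Suc k"]) (use hi in \<open>auto simp: less_imp_le\<close>)
  \<comment> \<open>The level \<open>c/2\<close>, below the weak bound \<open>3*c/4\<close> for
    \<open>F u\<close> at \<open>z k\<close>, makes \<open>C k\<close> an open set around
    \<open>z k\<close>.\<close>
  define C where "C k = {v \<in> topspace Z. F u v > c/2} \<inter> (\<Inter>i\<le>k. {v \<in> topspace Z. F (t i) v < c/4})"
    for k
  have C: "openin Z (C k)" "C k \<noteq> {}" for k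
  proof -
    show "openin Z (C k)"
      unfolding C_def
      by (intro openin_Int openin_INT2 openin_continuous_map_real_gt
          openin_continuous_map_real_lt FZ uK tK) auto
    have "z k \<in> C k"
      using zZ lo Fu [of k] c by (auto simp: C_def)
    then show "C k \<noteq> {}" by blast
  qed
  obtain v where v: "cluster_point_of_sets Z C v"
    using pseudocompact_space_cluster_point [of Z C] Z C by blast
  have vZ: "v \<in> topspace Z"
    using v by (simp add: cluster_point_of_sets_def)
  have "F u v \<ge> c/2"
    using v FZ [OF uK] by (rule cluster_point_of_sets_ge [of Z C _ _ 0]) (auto simp: C_def)
  moreover have "F (t i) v \<le> c/4" for i
    using v FZ [OF tK]
    by (rule cluster_point_of_sets_le [of Z C _ _ i]) (auto simp: C_def less_imp_le)
  then have "F u v \<le> c/4"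
    using u FK [OF vZ] by (rule_tac cluster_point_of_sets_le [of K _ _ _ 0]) auto
  ultimately show False
    using c by simp
qed

section \<open>Algebra of limits and continuity of a limit in a parameter\<close>

lemma Lim_add_mult:
  fixes f :: "'a \<Rightarrow> real"
  assumes p: "converging_filter X p" and f: "continuous_map X euclideanreal f"
  shows "Lim p (\<lambda>t. a * f t + b) = a * Lim p f + b"
  using p by (intro tendsto_Lim tendsto_intros converging_filter_tendsto_Lim [OF p f])
    (simp add: converging_filter_def trivial_limit_def)

lemma Lim_min:
  fixes f g :: "'a \<Rightarrow> real"
  assumes p: "converging_filter X p" and f: "continuous_map X euclideanreal f"
    and g: "continuous_map X euclideanreal g"
  shows "Lim p (\<lambda>t. min (f t) (g t)) = min (Lim p f) (Lim p g)"
  using p by (intro tendsto_Lim tendsto_min converging_filter_tendsto_Lim [OF p] f g)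
    (simp add: converging_filter_def trivial_limit_def)

lemma continuous_map_real_add_mult:
  fixes f :: "'a \<Rightarrow> real"
  assumes "continuous_map X euclideanreal f"
  shows "continuous_map X euclideanreal (\<lambda>x. a * f x + b)"
  using assms by (intro continuous_intros) auto

text \<open>The cases \<open>a = 1\<close> and \<open>a = -1\<close> give lower and upper
  semicontinuity. Continuity is thus reduced to openness of positivity, the form that the limit
  arguments deliver.\<close>

lemma continuous_map_real_if_pos_neighbourhoods:
  fixes H :: "'a \<Rightarrow> real"
  assumes "\<And>a b x. x \<in> topspace X \<Longrightarrow> a * H x + b > 0 \<Longrightarrow>
    \<exists>T. openin X T \<and> x \<in> T \<and> (\<forall>t\<in>T. a * H t + b > 0)"
  shows "continuous_map X euclideanreal H"
proof -
  have op: "openin X {x \<in> topspace X. a * H x + b > 0}" for a b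
  proof (rule openin_subopen [THEN iffD2], intro ballI)
    fix x assume "x \<in> {x \<in> topspace X. a * H x + b > 0}"
    then obtain T where "openin X T" "x \<in> T" "\<forall>t\<in>T. a * H t + b > 0"
      using assms [of x a b] by blast
    then show "\<exists>T. openin X T \<and> x \<in> T \<and> T \<subseteq> {x \<in> topspace X. a * H x + b > 0}"
      using openin_subset by (intro exI [of _ T]) blast
  qed
  show ?thesis
    unfolding continuous_map_upper_lower_semicontinuous_lt
    using op [of 1 "- a" for a] op [of "-1" a for a] by simp
qed

text \<open>Affine maps commute with the limit, so \<open>Lim_pos_neighbourhood\<close> applies to
  every affine image of \<open>F\<close>. In the theorem this preserves continuity in one point of a
  compactification while limits along later factors are taken.\<close>

lemma continuous_map_Lim:
  fixes F :: "'k \<Rightarrow> 'a \<Rightarrow> real"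
  assumes K: "compact_space K"
    and Z: "completely_regular_space Z" "pseudocompact_space Z"
    and p: "converging_filter Z p"
    and FK: "\<And>z. z \<in> topspace Z \<Longrightarrow> continuous_map K euclideanreal (\<lambda>t. F t z)"
    and FZ: "\<And>t. t \<in> topspace K \<Longrightarrow> continuous_map Z euclideanreal (F t)"
  shows "continuous_map K euclideanreal (\<lambda>t. Lim p (F t))"
proof (rule continuous_map_real_if_pos_neighbourhoods)
  fix a b s assume s: "s \<in> topspace K" "a * Lim p (F s) + b > 0"
  have eq: "Lim p (\<lambda>z. a * F t z + b) = a * Lim p (F t) + b" if "t \<in> topspace K" for t
    using Lim_add_mult [OF p FZ [OF that]] .
  have "\<exists>T. openin K T \<and> s \<in> T \<and> (\<forall>t\<in>T. Lim p (\<lambda>z. a * F t z + b) > 0)"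
    by (rule Lim_pos_neighbourhood [OF K Z p])
      (use s eq in \<open>auto intro!: continuous_map_real_add_mult FK FZ\<close>)
  then show "\<exists>T. openin K T \<and> s \<in> T \<and> (\<forall>t\<in>T. a * Lim p (F t) + b > 0)"
    using eq openin_subset by (metis in_mono)
qed

subsection \<open>Iterated limits\<close>

lemma Lim_cong_topspace:
  fixes f g :: "'a \<Rightarrow> real"
  assumes "converging_filter X p" "\<And>t. t \<in> topspace X \<Longrightarrow> f t = g t"
  shows "Lim p f = Lim p g"
proof -
  have "\<forall>\<^sub>F t in p. f t = g t"
    using assms by (auto simp: converging_filter_def elim: eventually_mono)
  then show ?thesis
    by (simp add: Topological_Spaces.Lim_def tendsto_cong)
qed

text \<open>Coordinate 1 is innermost, so its limit is taken first. Coordinates up to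
  \<open>m\<close> of \<open>x\<close> are overwritten, which lets all stages share one argument
  type. \<open>Lim\<close> is total; its value is meaningful once the preceding stage is known to
  converge.\<close>

primrec iterlim :: "(nat \<Rightarrow> 'a filter) \<Rightarrow> nat \<Rightarrow> ((nat \<Rightarrow> 'a) \<Rightarrow> real) \<Rightarrow> (nat \<Rightarrow> 'a) \<Rightarrow> real" where
  "iterlim p 0 \<Phi> x = \<Phi> x"
| "iterlim p (Suc m) \<Phi> x = Lim (p (Suc m)) (\<lambda>t. iterlim p m \<Phi> (x(Suc m := t)))"

text \<open>Fixing a later coordinate commutes with the limits, so a section of a stage is itself a
  stage of a section of \<open>\<Phi>\<close>.\<close>

lemma iterlim_upd:
  assumes "m < j"
  shows "iterlim p m (\<lambda>x. \<Phi> (x(j := z))) x = iterlim p m \<Phi> (x(j := z))"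
  using assms
proof (induction m arbitrary: x)
  case (Suc m)
  then have "x(Suc m := t, j := z) = x(j := z, Suc m := t)" for t
    by (simp add: fun_upd_twist)
  then have "iterlim p m (\<lambda>x. \<Phi> (x(j := z))) (x(Suc m := t)) = iterlim p m \<Phi> (x(j := z, Suc m := t))" for t
    using Suc.IH [of "x(Suc m := t)"] Suc.prems by (metis Suc_lessD)
  then show ?case
    by (simp only: iterlim.simps)
qed simp

lemma iterlim_cong:
  assumes "\<And>i. i \<notin> {1..m} \<Longrightarrow> x i = y i"
  shows "iterlim p m \<Phi> x = iterlim p m \<Phi> y"
  using assms
proof (induction m arbitrary: x y)
  case 0
  then have "x = y" by auto
  then show ?case by simp
next
  case (Suc m)
  have "iterlim p m \<Phi> (x(Suc m := t)) = iterlim p m \<Phi> (y(Suc m := t))" for t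
    using Suc.prems by (intro Suc.IH) auto
  then show ?case by simp
qed

lemma iterlim_filter_cong:
  assumes "\<And>i. i \<in> {1..m} \<Longrightarrow> p i = q i"
  shows "iterlim p m \<Phi> x = iterlim q m \<Phi> x"
  using assms by (induction m arbitrary: x) auto

section \<open>Separate continuity and algebra of the stages\<close>

locale iterated_limits =
  fixes n :: nat and X :: "nat \<Rightarrow> 'a topology" and p :: "nat \<Rightarrow> 'a filter"
  assumes creg: "\<And>i. i \<in> {1..n} \<Longrightarrow> completely_regular_space (X i)"
    and pcomp: "\<And>i. i \<in> {1..n} \<Longrightarrow> pseudocompact_space (X i)"
    and filt: "\<And>i. i \<in> {1..n} \<Longrightarrow> converging_filter (X i) (p i)"
begin

abbreviation XX :: "(nat \<Rightarrow> 'a) topology" where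
  "XX \<equiv> product_topology X {1..n}"

lemma upd_in_XX:
  "\<lbrakk>x \<in> topspace XX; i \<in> {1..n}; t \<in> topspace (X i)\<rbrakk> \<Longrightarrow> x(i := t) \<in> topspace XX"
  by (auto simp: PiE_iff extensional_def)

lemma in_XX_D: "\<lbrakk>x \<in> topspace XX; i \<in> {1..n}\<rbrakk> \<Longrightarrow> x i \<in> topspace (X i)"
  by (auto simp: PiE_iff)

lemma continuous_map_upd:
  assumes "i \<in> {1..n}" "t \<in> topspace (X i)"
  shows "continuous_map XX XX (\<lambda>x. x(i := t))"
  unfolding continuous_map_componentwise
proof (intro conjI ballI)
  show "(\<lambda>x. x(i := t)) ` topspace XX \<subseteq> extensional {1..n}"
    using assms by (auto simp: PiE_iff extensional_def)
  fix k assume k: "k \<in> {1..n}"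
  show "continuous_map XX (X k) (\<lambda>x. (x(i := t)) k)"
    using assms k continuous_map_product_projection [OF k, of X] by (cases "k = i") auto
qed

lemma continuous_map_upd_affine:
  fixes \<Phi> :: "(nat \<Rightarrow> 'a) \<Rightarrow> real"
  assumes "continuous_map XX euclideanreal \<Phi>" "i \<in> {1..n}" "t \<in> topspace (X i)"
  shows "continuous_map XX euclideanreal (\<lambda>x. r * \<Phi> (x(i := t)) + s)"
  using continuous_map_compose [OF continuous_map_upd [OF assms(2,3)] assms(1)]
  by (intro continuous_map_real_add_mult) (simp add: o_def)

text \<open>All continuous \<open>\<Phi>\<close> are covered at once, because the argument passes to
  sections, affine combinations and minima of a given function. The case \<open>i = m + 1\<close>
  makes the next limit exist.\<close>

definition sepcont :: "nat \<Rightarrow> bool" where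
  "sepcont m \<longleftrightarrow> (\<forall>\<Phi> x i. continuous_map XX euclideanreal \<Phi> \<longrightarrow> x \<in> topspace XX \<longrightarrow> i \<in> {m<..n} \<longrightarrow>
     continuous_map (X i) euclideanreal (\<lambda>t. iterlim p m \<Phi> (x(i := t))))"

text \<open>Separate continuity of the earlier stages makes each single limit exist, and existing
  limits commute with affine maps; \<open>iterlim_min\<close> works the same way.\<close>

lemma iterlim_affine:
  assumes "m \<le> n" "\<And>k. k < m \<Longrightarrow> sepcont k" "continuous_map XX euclideanreal \<Phi>" "x \<in> topspace XX"
  shows "iterlim p m (\<lambda>x. r * \<Phi> x + s) x = r * iterlim p m \<Phi> x + s"
  using assms
proof (induction m arbitrary: x)
  case (Suc m)
  let ?q = "Suc m"
  have q: "?q \<in> {1..n}" using Suc.prems by auto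
  have "Lim (p ?q) (\<lambda>t. iterlim p m (\<lambda>x. r * \<Phi> x + s) (x(?q := t))) =
      Lim (p ?q) (\<lambda>t. r * iterlim p m \<Phi> (x(?q := t)) + s)"
    using Suc.prems q by (intro Lim_cong_topspace [OF filt] Suc.IH upd_in_XX) auto
  also have "\<dots> = r * Lim (p ?q) (\<lambda>t. iterlim p m \<Phi> (x(?q := t))) + s"
    using Suc.prems q by (intro Lim_add_mult [OF filt]) (auto simp: sepcont_def)
  finally show ?case by simp
qed simp

lemma iterlim_min:
  assumes "m \<le> n" "\<And>k. k < m \<Longrightarrow> sepcont k" "continuous_map XX euclideanreal \<Phi>"
    "continuous_map XX euclideanreal \<Psi>" "x \<in> topspace XX"
  shows "iterlim p m (\<lambda>x. min (\<Phi> x) (\<Psi> x)) x = min (iterlim p m \<Phi> x) (iterlim p m \<Psi> x)"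
  using assms
proof (induction m arbitrary: x)
  case (Suc m)
  let ?q = "Suc m"
  have q: "?q \<in> {1..n}" using Suc.prems by auto
  have "Lim (p ?q) (\<lambda>t. iterlim p m (\<lambda>x. min (\<Phi> x) (\<Psi> x)) (x(?q := t))) =
      Lim (p ?q) (\<lambda>t. min (iterlim p m \<Phi> (x(?q := t))) (iterlim p m \<Psi> (x(?q := t))))"
    using Suc.prems q by (intro Lim_cong_topspace [OF filt] Suc.IH upd_in_XX) auto
  also have "\<dots> = min (Lim (p ?q) (\<lambda>t. iterlim p m \<Phi> (x(?q := t))))
      (Lim (p ?q) (\<lambda>t. iterlim p m \<Psi> (x(?q := t))))"
    using Suc.prems q by (intro Lim_min [OF filt]) (auto simp: sepcont_def)
  finally show ?case by simp
qed simp

text \<open>Minima merge finitely many positivity conditions into one, so a single use of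
  quasicontinuity yields a box that serves them all.\<close>

lemma iterlim_pos_family:
  assumes m: "m \<le> n" "\<And>k. k < m \<Longrightarrow> sepcont k"
    and "finite G" "\<And>\<Phi>. \<Phi> \<in> G \<Longrightarrow> continuous_map XX euclideanreal \<Phi>"
  shows "\<exists>\<Psi>. continuous_map XX euclideanreal \<Psi> \<and>
    (\<forall>x\<in>topspace XX. iterlim p m \<Psi> x > 0 \<longleftrightarrow> (\<forall>\<Phi>\<in>G. iterlim p m \<Phi> x > 0))"
  using assms(3,4)
proof (induction G)
  case empty
  have "iterlim p m (\<lambda>x. 0 * (0::real) + 1) x = 1" if "x \<in> topspace XX" for x
    using iterlim_affine [OF m, of "\<lambda>_. 0" x 0 1] that by simp
  then show ?case
    by (intro exI [of _ "\<lambda>x. 0 * (0::real) + 1"]) simp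
next
  case (insert \<Phi> G)
  then obtain \<Psi> where \<Psi>: "continuous_map XX euclideanreal \<Psi>"
    "\<forall>x\<in>topspace XX. iterlim p m \<Psi> x > 0 \<longleftrightarrow> (\<forall>\<Phi>\<in>G. iterlim p m \<Phi> x > 0)"
    by auto
  have \<Phi>: "continuous_map XX euclideanreal \<Phi>"
    using insert by simp
  show ?case
    using \<Psi> \<Phi> iterlim_min [OF m \<Phi> \<Psi>(1)]
    by (intro exI [of _ "\<lambda>x. min (\<Phi> x) (\<Psi> x)"]) (auto intro: continuous_map_real_min)
qed

lemma tendsto_iterlim:
  assumes "sepcont m" "Suc m \<le> n" "continuous_map XX euclideanreal \<Phi>" "x \<in> topspace XX"
  shows "((\<lambda>t. iterlim p m \<Phi> (x(Suc m := t))) \<longlongrightarrow> iterlim p (Suc m) \<Phi> x) (p (Suc m))"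
  using assms unfolding iterlim.simps
  by (intro converging_filter_tendsto_Lim [OF filt]) (auto simp: sepcont_def)

text \<open>Coordinates up to \<open>m\<close> carry no further condition, since
  \<open>iterlim p m\<close> does not depend on them.\<close>

definition free_box :: "nat \<Rightarrow> nat set \<Rightarrow> (nat \<Rightarrow> 'a set) \<Rightarrow> (nat \<Rightarrow> 'a) \<Rightarrow> (nat \<Rightarrow> 'a) set" where
  "free_box m I B a = {x \<in> topspace XX. (\<forall>i\<in>I. x i \<in> B i) \<and> (\<forall>i\<in>{m<..n} - I. x i = a i)}"

lemma free_boxI:
  assumes "x \<in> topspace XX" "\<And>i. i \<in> I \<Longrightarrow> x i \<in> B i" "\<And>i. i \<in> {m<..n} \<Longrightarrow> i \<notin> I \<Longrightarrow> x i = a i"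
  shows "x \<in> free_box m I B a"
  using assms by (auto simp: free_box_def)

lemma free_box_nonempty:
  assumes "I \<subseteq> {m<..n}" "a \<in> topspace XX" "\<And>i. i \<in> I \<Longrightarrow> openin (X i) (B i) \<and> B i \<noteq> {}"
  shows "\<exists>x. x \<in> free_box m I B a"
proof
  let ?x = "\<lambda>i. if i \<in> I then SOME t. t \<in> B i else a i"
  have B: "(SOME t. t \<in> B i) \<in> B i" if "i \<in> I" for i
    using assms(3) [OF that] by (simp add: some_in_eq)
  moreover have "(SOME t. t \<in> B i) \<in> topspace (X i)" if "i \<in> I" for i
    using B assms(3) openin_subset that by blast
  then have "?x \<in> topspace XX"
    using assms(1,2) by (auto simp: PiE_iff extensional_def)
  ultimately show "?x \<in> free_box m I B a"
    by (intro free_boxI) auto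
qed

text \<open>Positivity suffices in place of closeness, because affine combinations and minima of functions
  commute with the iterated limits.  At most one side of the box, the one with index \<open>j\<close>, is required
  to contain the coordinate of \<open>a\<close>.\<close>

definition quasicont :: "nat \<Rightarrow> nat set \<Rightarrow> bool" where
  "quasicont m I \<longleftrightarrow> (\<forall>\<Phi> a U j.
     continuous_map XX euclideanreal \<Phi> \<longrightarrow> a \<in> topspace XX \<longrightarrow>
     (\<forall>i\<in>I. openin (X i) (U i) \<and> a i \<in> U i) \<longrightarrow> iterlim p m \<Phi> a > 0 \<longrightarrow>
     (\<exists>B. (\<forall>i\<in>I. openin (X i) (B i) \<and> B i \<noteq> {} \<and> B i \<subseteq> U i) \<and> (j \<in> I \<longrightarrow> a j \<in> B j) \<and>
       (\<forall>x\<in>free_box m I B a. iterlim p m \<Phi> x > 0)))"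

lemma quasicontD:
  assumes "quasicont m I" "continuous_map XX euclideanreal \<Phi>" "a \<in> topspace XX"
    "\<And>i. i \<in> I \<Longrightarrow> openin (X i) (U i)" "\<And>i. i \<in> I \<Longrightarrow> a i \<in> U i" "iterlim p m \<Phi> a > 0"
  obtains B where "\<And>i. i \<in> I \<Longrightarrow> openin (X i) (B i)" "\<And>i. i \<in> I \<Longrightarrow> B i \<noteq> {}"
    "\<And>i. i \<in> I \<Longrightarrow> B i \<subseteq> U i" "j \<in> I \<Longrightarrow> a j \<in> B j"
    "\<And>x. x \<in> free_box m I B a \<Longrightarrow> iterlim p m \<Phi> x > 0"
proof -
  have "\<exists>B. (\<forall>i\<in>I. openin (X i) (B i) \<and> B i \<noteq> {} \<and> B i \<subseteq> U i) \<and> (j \<in> I \<longrightarrow> a j \<in> B j) \<and>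
       (\<forall>x\<in>free_box m I B a. iterlim p m \<Phi> x > 0)"
    using assms by (simp add: quasicont_def)
  then show thesis
    using that by metis
qed

section \<open>Base cases of quasicontinuity, and separate continuity from it\<close>

lemma quasicont_empty:
  assumes "m \<le> n"
  shows "quasicont m {}"
proof -
  have "iterlim p m \<Phi> x = iterlim p m \<Phi> a" if "x \<in> free_box m {} B a" "a \<in> topspace XX" for x a B \<Phi>
  proof (rule iterlim_cong)
    fix i assume i: "i \<notin> {1..m}"
    show "x i = a i"
    proof (cases "i \<in> {m<..n}")
      case False
      then have "i \<notin> {1..n}" using i by auto
      then show ?thesis
        using that by (auto simp: free_box_def PiE_iff extensional_def)
    qed (use that in \<open>auto simp: free_box_def\<close>)
  qed
  then show ?thesis
    by (simp add: quasicont_def)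
qed

text \<open>Joint continuity of \<open>\<Phi>\<close> enters here: a basic neighbourhood of
  \<open>a\<close> on which \<open>\<Phi>\<close> is positive supplies all sides of the box.\<close>

lemma quasicont_0:
  assumes I: "I \<subseteq> {1..n}"
  shows "quasicont 0 I"
  unfolding quasicont_def
proof (intro allI impI)
  fix \<Phi> :: "(nat \<Rightarrow> 'a) \<Rightarrow> real" and a U j
  assume \<Phi>: "continuous_map XX euclideanreal \<Phi>" and a: "a \<in> topspace XX"
    and U: "\<forall>i\<in>I. openin (X i) (U i) \<and> a i \<in> U i" and pos: "iterlim p 0 \<Phi> a > 0"
  have "openin XX {x \<in> topspace XX. \<Phi> x > 0}"
    by (rule openin_continuous_map_real_gt [OF \<Phi>])
  moreover have "a \<in> {x \<in> topspace XX. \<Phi> x > 0}"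
    using a pos by simp
  ultimately obtain V where V: "\<forall>i\<in>{1..n}. openin (X i) (V i)" "a \<in> Pi\<^sub>E {1..n} V"
    "Pi\<^sub>E {1..n} V \<subseteq> {x \<in> topspace XX. \<Phi> x > 0}"
    unfolding openin_product_topology_alt by meson
  have aV: "a i \<in> V i" if "i \<in> {1..n}" for i
    using V(2) that by auto
  show "\<exists>B. (\<forall>i\<in>I. openin (X i) (B i) \<and> B i \<noteq> {} \<and> B i \<subseteq> U i) \<and> (j \<in> I \<longrightarrow> a j \<in> B j) \<and>
       (\<forall>x\<in>free_box 0 I B a. iterlim p 0 \<Phi> x > 0)"
  proof (intro exI [of _ "\<lambda>i. U i \<inter> V i"] conjI ballI impI)
    show "openin (X i) (U i \<inter> V i)" "U i \<inter> V i \<noteq> {}" if "i \<in> I" for i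
      using that U V(1) aV I by (blast intro: openin_Int)+
    fix x assume x: "x \<in> free_box 0 I (\<lambda>i. U i \<inter> V i) a"
    have "x i \<in> V i" if "i \<in> {1..n}" for i
      using x aV that by (cases "i \<in> I") (auto simp: free_box_def)
    then have "x \<in> Pi\<^sub>E {1..n} V"
      using x by (auto simp: free_box_def PiE_iff)
    then show "iterlim p 0 \<Phi> x > 0"
      using V(3) by auto
  qed (use U aV I in auto)
qed

text \<open>With \<open>i\<close> as the only side and also the chosen one, the box is a
  neighbourhood of the coordinate while the later others stay fixed. Applied to affine images, this
  gives openness of positivity along \<open>X i\<close>.\<close>

lemma sepcont_if_quasicont:
  assumes m: "m \<le> n" "\<And>k. k < m \<Longrightarrow> sepcont k" and "\<And>i. i \<in> {m<..n} \<Longrightarrow> quasicont m {i}"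
  shows "sepcont m"
  unfolding sepcont_def
proof (intro allI impI)
  fix \<Phi> :: "(nat \<Rightarrow> 'a) \<Rightarrow> real" and x i
  assume \<Phi>: "continuous_map XX euclideanreal \<Phi>" and x: "x \<in> topspace XX" and i: "i \<in> {m<..n}"
  have i': "i \<in> {1..n}" using i by auto
  show "continuous_map (X i) euclideanreal (\<lambda>t. iterlim p m \<Phi> (x(i := t)))"
  proof (rule continuous_map_real_if_pos_neighbourhoods)
    fix r s t assume t: "t \<in> topspace (X i)" and pos: "r * iterlim p m \<Phi> (x(i := t)) + s > 0"
    have eq: "iterlim p m (\<lambda>x. r * \<Phi> x + s) (x(i := u)) = r * iterlim p m \<Phi> (x(i := u)) + s"
      if "u \<in> topspace (X i)" for u
      by (intro iterlim_affine m \<Phi> upd_in_XX x i' that)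
    obtain B where B: "\<And>k. k \<in> {i} \<Longrightarrow> openin (X k) (B k)" "i \<in> {i} \<Longrightarrow> (x(i := t)) i \<in> B i"
      "\<And>y. y \<in> free_box m {i} B (x(i := t)) \<Longrightarrow> iterlim p m (\<lambda>x. r * \<Phi> x + s) y > 0"
      by (rule quasicontD [OF assms(3) [OF i] continuous_map_real_add_mult [OF \<Phi>, of r s]
            upd_in_XX [OF x i' t], of "\<lambda>i. topspace (X i)" i])
        (use eq [OF t] pos t in auto)
    have "r * iterlim p m \<Phi> (x(i := u)) + s > 0" if "u \<in> B i" for u
    proof -
      have u: "u \<in> topspace (X i)"
        using that B(1) openin_subset by blast
      have "x(i := u) \<in> free_box m {i} B (x(i := t))"
        using upd_in_XX [OF x i' u] that by (intro free_boxI) auto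
      then show ?thesis
        using B(3) eq [OF u] by metis
    qed
    then show "\<exists>T. openin (X i) T \<and> t \<in> T \<and> (\<forall>u\<in>T. r * iterlim p m \<Phi> (x(i := u)) + s > 0)"
      using B(1,2) by (intro exI [of _ "B i"]) auto
  qed
qed

text \<open>One more limit, along \<open>X q\<close>, is added. At the new stage, \<open>Q1\<close>
  shrinks the other sides while coordinate \<open>j\<close> is fixed. At the old stage,
  \<open>Q2\<close> spreads finitely many inequalities over these sides and an open set in
  \<open>X q\<close>, and \<open>Q3\<close>, with chosen side \<open>j\<close>, keeps the function
  large on a neighbourhood of \<open>a j\<close>.\<close>

lemma quasicont_step:
  fixes m :: nat
  defines "q \<equiv> Suc m"
  assumes q: "q \<le> n" and I: "I \<subseteq> {q<..n}"
    and sc: "\<And>k. k \<le> m \<Longrightarrow> sepcont k"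
    and Q1: "\<And>j. j \<in> I \<Longrightarrow> quasicont q (I - {j})"
    and Q2: "\<And>j. j \<in> I \<Longrightarrow> quasicont m (insert q (I - {j}))"
    and Q3: "quasicont m (insert q I)"
    and \<Phi>: "continuous_map XX euclideanreal \<Phi>"
    and a: "a \<in> topspace XX" and j: "j \<in> I"
    and U: "\<And>i. i \<in> I \<Longrightarrow> openin (X i) (U i)" "\<And>i. i \<in> I \<Longrightarrow> a i \<in> U i"
    and pos: "iterlim p q \<Phi> a > 0"
  shows "\<exists>B. (\<forall>i\<in>I. openin (X i) (B i) \<and> B i \<noteq> {} \<and> B i \<subseteq> U i) \<and> a j \<in> B j \<and>
       (\<forall>x\<in>free_box q I B a. iterlim p q \<Phi> x > 0)"
proof (rule ccontr)
  assume neg: "\<not> ?thesis"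
  define J where "J = I - {j}"
  define f where "f = iterlim p m \<Phi>"
  define g where "g = iterlim p q \<Phi>"
  \<comment> \<open>The levels separate the value at \<open>a\<close>, which exceeds
    \<open>h\<close>, from the values at most 0 at the bad points that \<open>neg\<close>
    supplies.\<close>
  define l where "l = g a / 3"
  define h where "h = 2 * g a / 3"
  have lh: "0 < l" "l < h" "h < g a"
    using pos by (auto simp: l_def h_def g_def)
  define bx where "bx B = {x \<in> topspace XX. (\<forall>i\<in>J. x i \<in> B i) \<and> (\<forall>i\<in>{q<..n} - I. x i = a i)}"
    for B :: "nat \<Rightarrow> 'a set"
  have m: "m \<le> n" "m < q" "q \<in> {1..n}" "q \<notin> I" "{m<..n} = insert q {q<..n}"
    using q I by (auto simp: q_def)
  have jn: "j \<in> {1..n}" "j \<in> {q<..n}" "j \<noteq> q" "m < j" "q < j" "j \<in> {m<..n}"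
    using I j by (auto simp: q_def)
  have IJ: "I = insert j J" "j \<notin> J" "J \<subseteq> {q<..n}" "J \<subseteq> {1..n}" "q \<notin> J" "J \<subseteq> I"
    using I j by (auto simp: J_def q_def)
  have scq: "sepcont k" if "k < q" for k
    using sc that by (auto simp: q_def)
  have scm: "sepcont k" if "k < m" for k
    using sc that by auto
  have aj: "a j \<in> topspace (X j)"
    using a jn in_XX_D by blast
  have aff_g: "iterlim p q (\<lambda>x. r * \<Phi> (x(j := z)) + s) x = r * g (x(j := z)) + s"
    and aff_f: "iterlim p m (\<lambda>x. r * \<Phi> (x(j := z)) + s) x = r * f (x(j := z)) + s"
    if "z \<in> topspace (X j)" "x \<in> topspace XX" for r s z x
  proof -
    have c: "continuous_map XX euclideanreal (\<lambda>x. \<Phi> (x(j := z)))"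
      using continuous_map_upd_affine [OF \<Phi> jn(1) that(1), of 1 0] by simp
    show "iterlim p q (\<lambda>x. r * \<Phi> (x(j := z)) + s) x = r * g (x(j := z)) + s"
      using iterlim_affine [OF q scq c that(2)] iterlim_upd [OF jn(5), of p \<Phi> z x] by (simp add: g_def)
    show "iterlim p m (\<lambda>x. r * \<Phi> (x(j := z)) + s) x = r * f (x(j := z)) + s"
      using iterlim_affine [OF m(1) scm c that(2)] iterlim_upd [OF jn(4), of p \<Phi> z x] by (simp add: f_def)
  qed
  have bx_mono: "bx B \<subseteq> bx B'" if "\<And>i. i \<in> J \<Longrightarrow> B i \<subseteq> B' i" for B B'
    using that by (auto simp: bx_def)
  have bx_XX: "x \<in> topspace XX" if "x \<in> bx B" for x B
    using that by (simp add: bx_def)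

  define opens where "opens B \<longleftrightarrow> (\<forall>i\<in>J. openin (X i) (B i) \<and> B i \<noteq> {} \<and> B i \<subseteq> U i)" for B
  \<comment> \<open>\<open>B\<close> gives the sides other than \<open>j\<close>, \<open>V\<close>
    the neighbourhood of \<open>a j\<close>, and \<open>Zs\<close> the points of \<open>X j\<close>
    chosen so far. Here the inequalities concern \<open>g\<close>; those for \<open>f\<close> on
    \<open>W\<close> are recorded in \<open>nxt\<close>.\<close>
  define inv where "inv B V Zs \<longleftrightarrow> opens B \<and> openin (X j) V \<and> a j \<in> V \<and> V \<subseteq> U j \<and>
      finite Zs \<and> Zs \<subseteq> topspace (X j) \<and>
      (\<forall>x\<in>bx B. (\<forall>z\<in>Zs. g (x(j := z)) < l) \<and> g (x(j := a j)) > h)" for B V Zs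
  define nxt where "nxt B V Zs B' V' Zs' W z \<longleftrightarrow> z \<in> V \<and> Zs' = insert z Zs \<and> V' \<subseteq> V \<and>
      (\<forall>i\<in>J. X i closure_of B' i \<subseteq> B i) \<and> openin (X q) W \<and> W \<noteq> {} \<and>
      (\<forall>x\<in>bx B'. x q \<in> W \<longrightarrow> (\<forall>z\<in>Zs'. f (x(j := z)) < l) \<and> (\<forall>v\<in>V'. f (x(j := v)) > h))"
    for B V Zs B' V' Zs' W z

  have init: "\<exists>B V Zs. inv B V Zs"
  proof -
    obtain B where B: "\<And>i. i \<in> J \<Longrightarrow> openin (X i) (B i)" "\<And>i. i \<in> J \<Longrightarrow> B i \<noteq> {}"
      "\<And>i. i \<in> J \<Longrightarrow> B i \<subseteq> U i"
      "\<And>x. x \<in> free_box q J B a \<Longrightarrow> iterlim p q (\<lambda>x. 1 * \<Phi> (x(j := a j)) + - h) x > 0"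
      by (rule quasicontD [OF Q1 [OF j, folded J_def] continuous_map_upd_affine [OF \<Phi> jn(1) aj, of 1 "- h"] a, of U])
        (use aff_g [OF aj a, of 1 "-h"] U IJ lh in auto)
    have "g (x(j := a j)) > h" if "x \<in> bx B" for x
    proof -
      have x: "x(j := a j) \<in> topspace XX"
        by (rule upd_in_XX [OF bx_XX [OF that] jn(1) aj])
      then have "x(j := a j) \<in> free_box q J B a"
        using that IJ by (intro free_boxI) (auto simp: bx_def)
      then show ?thesis
        using B(4) aff_g [OF aj x, of 1 "-h"] by force
    qed
    then have "inv B (U j) {}"
      using B U j by (auto simp: inv_def opens_def)
    then show ?thesis by blast
  qed

  have step: "\<exists>B' V' Zs' W z. inv B' V' Zs' \<and> nxt B V Zs B' V' Zs' W z" if inv: "inv B V Zs" for B V Zs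
  proof -
    have B: "\<And>i. i \<in> J \<Longrightarrow> openin (X i) (B i)" "\<And>i. i \<in> J \<Longrightarrow> B i \<noteq> {}" "\<And>i. i \<in> J \<Longrightarrow> B i \<subseteq> U i"
      and V: "openin (X j) V" "a j \<in> V" "V \<subseteq> U j" and Zs: "finite Zs" "Zs \<subseteq> topspace (X j)"
      and near: "\<And>x. x \<in> bx B \<Longrightarrow> g (x(j := a j)) > h"
      and far: "\<And>x z. x \<in> bx B \<Longrightarrow> z \<in> Zs \<Longrightarrow> g (x(j := z)) < l"
      using inv by (auto simp: inv_def opens_def)
    have "(\<forall>i\<in>I. openin (X i) ((B(j := V)) i) \<and> (B(j := V)) i \<noteq> {} \<and> (B(j := V)) i \<subseteq> U i) \<and>
        a j \<in> (B(j := V)) j"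
      using B V IJ by auto
    \<comment> \<open>The assumed failure, applied to the current box, gives a bad point; its
      coordinate \<open>j\<close> becomes the next \<open>z\<close>.\<close>
    then obtain x0 where x0: "x0 \<in> free_box q I (B(j := V)) a" "g x0 \<le> 0"
      using neg unfolding g_def [symmetric] by (metis not_le)
    define z where "z = x0 j"
    have x0X: "x0 \<in> topspace XX" and zV: "z \<in> V"
      using x0 IJ by (auto simp: free_box_def z_def)
    have zX: "z \<in> topspace (X j)"
      using zV V openin_subset by blast
    have x0a: "x0 i = a i" if "i \<in> {q<..n}" "i \<notin> I" for i
      using x0 that by (auto simp: free_box_def)
    have x0B: "x0 i \<in> B i" if "i \<in> J" for i
      using x0 that IJ by (auto simp: free_box_def split: if_splits)
    have x0z: "x0(j := z) = x0"
      by (simp add: z_def)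
    obtain B1 where B1: "\<And>i. i \<in> J \<Longrightarrow> openin (X i) (B1 i)" "\<And>i. i \<in> J \<Longrightarrow> B1 i \<noteq> {}"
      "\<And>i. i \<in> J \<Longrightarrow> B1 i \<subseteq> B i"
      "\<And>x. x \<in> free_box q J B1 x0 \<Longrightarrow> iterlim p q (\<lambda>x. - 1 * \<Phi> (x(j := z)) + l) x > 0"
      by (rule quasicontD [OF Q1 [OF j, folded J_def] continuous_map_upd_affine [OF \<Phi> jn(1) zX, of "- 1" l] x0X, of B])
        (use aff_g [OF zX x0X, of "- 1" l] B x0B x0(2) x0z lh in auto)
    have B1B: "bx B1 \<subseteq> bx B"
      using B1 by (intro bx_mono)
    have "g (x(j := z)) < l" if "x \<in> bx B1" for x
    proof -
      have x: "x(j := z) \<in> topspace XX"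
        by (rule upd_in_XX [OF bx_XX [OF that] jn(1) zX])
      then have "x(j := z) \<in> free_box q J B1 x0"
        using that IJ x0a by (intro free_boxI) (auto simp: bx_def z_def)
      then show ?thesis
        using B1(4) aff_g [OF zX x, of "-1" l] by force
    qed
    then have far1: "g (x(j := y)) < l" if "x \<in> bx B1" "y \<in> insert z Zs" for x y
      using that far B1B by auto
    have near1: "g (x(j := a j)) > h" if "x \<in> bx B1" for x
      using that near B1B by auto
    have Zs': "y \<in> topspace (X j)" if "y \<in> insert z Zs" for y
      using that zX Zs by auto
    obtain x1 where "x1 \<in> free_box q J B1 a"
      using free_box_nonempty [OF IJ(3) a] B1 by metis
    then have x1: "x1 \<in> bx B1"
      using IJ by (auto simp: free_box_def bx_def)
    have x1X: "x1 \<in> topspace XX"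
      by (rule bx_XX [OF x1])
    \<comment> \<open>\<open>g\<close> is the limit of \<open>f\<close> along \<open>p q\<close>, so
      finitely many strict inequalities for \<open>g\<close> at \<open>x1\<close> hold for
      \<open>f\<close> at one suitable \<open>t\<close>.\<close>
    have lim: "((\<lambda>t. f (x1(q := t, j := y))) \<longlongrightarrow> g (x1(j := y))) (p q)" if "y \<in> topspace (X j)" for y
      using tendsto_iterlim [OF sc, of m \<Phi> "x1(j := y)"] upd_in_XX [OF x1X jn(1) that] \<Phi> q jn
      by (simp add: f_def g_def q_def fun_upd_twist)
    have "\<forall>\<^sub>F t in p q. \<forall>y\<in>insert z Zs. f (x1(q := t, j := y)) < l"
      using Zs(1) far1 [OF x1] Zs' by (intro eventually_ball_finite ballI order_tendstoD(2) [OF lim]) auto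
    moreover have "\<forall>\<^sub>F t in p q. f (x1(q := t, j := a j)) > h"
      using near1 [OF x1] by (rule order_tendstoD(1) [OF lim [OF aj]])
    moreover have "\<forall>\<^sub>F t in p q. t \<in> topspace (X q)"
      using filt [OF m(3)] by (auto simp: converging_filter_def)
    ultimately have "\<forall>\<^sub>F t in p q. (\<forall>y\<in>insert z Zs. f (x1(q := t, j := y)) < l) \<and>
        f (x1(q := t, j := a j)) > h \<and> t \<in> topspace (X q)"
      by (intro eventually_conj)
    moreover have "p q \<noteq> bot"
      using filt [OF m(3)] by (auto simp: converging_filter_def)
    ultimately obtain t where t: "\<forall>y\<in>insert z Zs. f (x1(q := t, j := y)) < l"
      "f (x1(q := t, j := a j)) > h" "t \<in> topspace (X q)"
      using eventually_happens' by blast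
    define x2 where "x2 = x1(q := t)"
    have x2X: "x2 \<in> topspace XX"
      unfolding x2_def by (rule upd_in_XX [OF x1X m(3) t(3)])
    have x2a: "x2 i = a i" if "i \<in> {q<..n}" "i \<notin> I" for i
      using x1 that by (auto simp: bx_def x2_def)
    \<comment> \<open>Each inequality required of \<open>f\<close> becomes positivity for one member
      of \<open>G\<close>, and \<open>\<Psi>\<close> merges them.\<close>
    define G where "G = insert (\<lambda>x. 1 * \<Phi> (x(j := a j)) + - h)
      ((\<lambda>y x. - 1 * \<Phi> (x(j := y)) + l) ` insert z Zs)"
    have "\<exists>\<Psi>. continuous_map XX euclideanreal \<Psi> \<and>
        (\<forall>x\<in>topspace XX. iterlim p m \<Psi> x > 0 \<longleftrightarrow> (\<forall>\<Phi>\<in>G. iterlim p m \<Phi> x > 0))"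
    proof (rule iterlim_pos_family [OF m(1) scm])
      show "finite G"
        using Zs by (simp add: G_def)
      show "continuous_map XX euclideanreal \<Psi>" if "\<Psi> \<in> G" for \<Psi>
        using that unfolding G_def
        by (auto simp only: insert_iff image_iff intro!: continuous_map_upd_affine [OF \<Phi> jn(1)] aj zX Zs')
    qed
    then obtain \<Psi> where \<Psi>: "continuous_map XX euclideanreal \<Psi>"
      and \<Psi>G: "\<And>x. x \<in> topspace XX \<Longrightarrow> iterlim p m \<Psi> x > 0 \<longleftrightarrow> (\<forall>\<Phi>\<in>G. iterlim p m \<Phi> x > 0)"
      by blast
    have \<Psi>pos: "iterlim p m \<Psi> x > 0 \<longleftrightarrow>
        f (x(j := a j)) > h \<and> (\<forall>y\<in>insert z Zs. f (x(j := y)) < l)" if "x \<in> topspace XX" for x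
      unfolding \<Psi>G [OF that] G_def ball_simps
      using aff_f [OF aj that, of 1 "-h"] aff_f [OF Zs' that, of _ "-1" l] by auto
    obtain B2 where B2: "\<And>i. i \<in> insert q J \<Longrightarrow> openin (X i) (B2 i)" "\<And>i. i \<in> insert q J \<Longrightarrow> B2 i \<noteq> {}"
      "\<And>i. i \<in> insert q J \<Longrightarrow> B2 i \<subseteq> (B1(q := topspace (X q))) i"
      "\<And>x. x \<in> free_box m (insert q J) B2 x2 \<Longrightarrow> iterlim p m \<Psi> x > 0"
    proof (rule quasicontD [OF Q2 [OF j, folded J_def] \<Psi> x2X, of "B1(q := topspace (X q))"])
      show "x2 i \<in> (B1(q := topspace (X q))) i" if "i \<in> insert q J" for i
        using x1 that IJ t by (auto simp: bx_def x2_def)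
      show "iterlim p m \<Psi> x2 > 0"
        unfolding \<Psi>pos [OF x2X] using t by (simp add: x2_def)
    qed (use B1 IJ in auto)
    have B2pos: "f (x(j := a j)) > h \<and> (\<forall>y\<in>insert z Zs. f (x(j := y)) < l)"
      if "x \<in> topspace XX" "\<And>i. i \<in> J \<Longrightarrow> x i \<in> B2 i" "x q \<in> B2 q"
        "\<And>i. i \<in> {q<..n} \<Longrightarrow> i \<notin> I \<Longrightarrow> x i = a i" for x
    proof -
      have jx2: "x2 j \<in> topspace (X j)"
        by (rule in_XX_D [OF x2X jn(1)])
      have xX: "x(j := x2 j) \<in> topspace XX"
        by (rule upd_in_XX [OF that(1) jn(1) jx2])
      then have "x(j := x2 j) \<in> free_box m (insert q J) B2 x2"
        using that IJ jn m x2a by (intro free_boxI) auto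
      then show ?thesis
        using B2(4) \<Psi>pos [OF xX] by force
    qed
    obtain x3' where x3': "x3' \<in> free_box m (insert q J) B2 x2"
      using free_box_nonempty [of "insert q J" m x2 B2] x2X B2 IJ m by blast
    \<comment> \<open>Moving coordinate \<open>j\<close> to \<open>a j\<close> stays within reach of
      \<open>B2pos\<close>, so \<open>f x3 > h\<close>; the chosen side of \<open>Q3\<close> is then
      a neighbourhood of \<open>a j\<close>.\<close>
    define x3 where "x3 = x3'(j := a j)"
    have x3X: "x3 \<in> topspace XX"
      using x3' upd_in_XX [OF _ jn(1) aj] by (auto simp: x3_def free_box_def)
    have x3j: "x3 j = a j"
      by (simp add: x3_def)
    have x3B: "x3 i \<in> B2 i" if "i \<in> insert q J" for i
      using x3' that IJ jn by (auto simp: free_box_def x3_def)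
    have x3a: "x3 i = a i" if "i \<in> {q<..n}" "i \<notin> I" for i
      using x3' that IJ jn x2a m by (auto simp: free_box_def x3_def)
    have "f x3 > h"
      using B2pos [OF x3X] x3B x3a by (simp add: x3_def)
    moreover have aff3: "iterlim p m (\<lambda>x. 1 * \<Phi> x + - h) x = f x - h" if "x \<in> topspace XX" for x
      using iterlim_affine [OF m(1) scm \<Phi> that, of 1 "-h"] by (simp add: f_def)
    ultimately have x3pos: "iterlim p m (\<lambda>x. 1 * \<Phi> x + - h) x3 > 0"
      using x3X by simp
    obtain B3 where B3: "\<And>i. i \<in> insert q I \<Longrightarrow> openin (X i) (B3 i)" "\<And>i. i \<in> insert q I \<Longrightarrow> B3 i \<noteq> {}"
      "\<And>i. i \<in> insert q I \<Longrightarrow> B3 i \<subseteq> (B2(j := V)) i" "j \<in> insert q I \<Longrightarrow> x3 j \<in> B3 j"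
      "\<And>x. x \<in> free_box m (insert q I) B3 x3 \<Longrightarrow> iterlim p m (\<lambda>x. 1 * \<Phi> x + - h) x > 0"
    proof (rule quasicontD [OF Q3 continuous_map_real_add_mult [OF \<Phi>, of 1 "-h"] x3X _ _ x3pos, of "B2(j := V)" j])
      show "openin (X i) ((B2(j := V)) i)" "x3 i \<in> (B2(j := V)) i" if "i \<in> insert q I" for i
        using that B2(1) x3B x3j V IJ by auto
    qed blast
    \<comment> \<open>Regularity yields sides whose closures lie in the former ones, as the later
      intersection argument requires.\<close>
    have "\<exists>T. openin (X i) T \<and> T \<noteq> {} \<and> X i closure_of T \<subseteq> B3 i" if "i \<in> J" for i
    proof -
      have i: "i \<in> {1..n}" "i \<in> insert q I" using that IJ by auto
      obtain b where b: "b \<in> B3 i" using B3(2) [OF i(2)] by blast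
      have "closedin (X i) (topspace (X i) - B3 i)" "b \<in> topspace (X i) - (topspace (X i) - B3 i)"
        using B3(1) [OF i(2)] b openin_subset by blast+
      then obtain T where T: "openin (X i) T" "b \<in> T" "disjnt (topspace (X i) - B3 i) (X i closure_of T)"
        using completely_regular_imp_regular_space [OF creg [OF i(1)]] unfolding regular_space by meson
      then have "X i closure_of T \<subseteq> B3 i"
        using closure_of_subset_topspace [of "X i" T] by (auto simp: disjnt_def)
      then show ?thesis using T by blast
    qed
    then obtain B' where B': "\<And>i. i \<in> J \<Longrightarrow> openin (X i) (B' i)" "\<And>i. i \<in> J \<Longrightarrow> B' i \<noteq> {}"
      "\<And>i. i \<in> J \<Longrightarrow> X i closure_of B' i \<subseteq> B3 i"
      by metis
    have B'3: "B' i \<subseteq> B3 i" if "i \<in> J" for i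
      using B' that closure_of_subset openin_subset by (metis order_trans)
    have B32: "B3 i \<subseteq> B2 i" if "i \<in> insert q J" for i
      using B3(3) [of i] that IJ jn by (auto split: if_splits)
    have B21: "B2 i \<subseteq> B1 i" if "i \<in> J" for i
      using B2(3) [of i] that IJ by (auto split: if_splits)
    have sub: "bx B' \<subseteq> bx B1"
      using B'3 B32 B21 by (intro bx_mono) blast
    have clB: "X i closure_of B' i \<subseteq> B i" if "i \<in> J" for i
      using B'(3) [OF that] B32 [of i] B21 [OF that] B1(3) [OF that] that by auto
    have "B' i \<subseteq> U i" if "i \<in> J" for i
      using B'3 [OF that] B32 [of i] B21 [OF that] B1(3) [OF that] B(3) [OF that] that by auto
    then have "opens B'"
      using B' by (auto simp: opens_def)
    moreover have V': "openin (X j) (B3 j)" "a j \<in> B3 j" "B3 j \<subseteq> V"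
      using B3(1) [of j] B3(3) [of j] B3(4) j by (auto simp: x3_def)
    ultimately have "inv B' (B3 j) (insert z Zs)"
      using V Zs Zs' far1 near1 sub by (auto simp: inv_def)
    moreover have "nxt B V Zs B' (B3 j) (insert z Zs) (B3 q) z"
      unfolding nxt_def
    proof (intro conjI ballI impI zV refl V' clB)
      show "openin (X q) (B3 q)" "B3 q \<noteq> {}"
        using B3 by auto
      fix x assume x: "x \<in> bx B'" "x q \<in> B3 q"
      have xX: "x \<in> topspace XX"
        using x bx_XX by blast
      have xa: "x i = a i" if "i \<in> {q<..n}" "i \<notin> I" for i
        using x that by (auto simp: bx_def)
      have xB3: "x i \<in> B3 i" if "i \<in> J" for i
        using x B'3 that by (auto simp: bx_def)
      show "f (x(j := y)) < l" if "y \<in> insert z Zs" for y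
      proof -
        have "x i \<in> B2 i" if "i \<in> J" for i
          using xB3 B32 that by auto
        moreover have "x q \<in> B2 q"
          using x(2) B32 by auto
        ultimately show ?thesis
          using B2pos [OF xX _ _ xa] that by auto
      qed
      show "f (x(j := v)) > h" if v: "v \<in> B3 j" for v
      proof -
        have "v \<in> topspace (X j)"
          using v V' openin_subset by blast
        then have X: "x(j := v) \<in> topspace XX"
          by (rule upd_in_XX [OF xX jn(1)])
        then have "x(j := v) \<in> free_box m (insert q I) B3 x3"
          using xB3 x v xa x3a IJ jn m by (intro free_boxI) auto
        then show ?thesis
          using B3(5) aff3 [OF X] by force
      qed
    qed
    ultimately show ?thesis by blast
  qed

  have "\<exists>S. \<forall>k. (case S k of (B, V, Zs) \<Rightarrow> inv B V Zs) \<and>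
      (case S k of (B, V, Zs) \<Rightarrow> case S (Suc k) of (B', V', Zs') \<Rightarrow> \<exists>W z. nxt B V Zs B' V' Zs' W z)"
  proof (rule dependent_nat_choice)
    show "\<exists>S. case S of (B, V, Zs) \<Rightarrow> inv B V Zs"
      using init by auto
    show "\<exists>S'. (case S' of (B, V, Zs) \<Rightarrow> inv B V Zs) \<and>
        (case S of (B, V, Zs) \<Rightarrow> case S' of (B', V', Zs') \<Rightarrow> \<exists>W z. nxt B V Zs B' V' Zs' W z)"
      if "case S of (B, V, Zs) \<Rightarrow> inv B V Zs" for S k
      using that step by (cases S) fastforce
  qed
  then obtain S where S: "\<forall>k. (case S k of (B, V, Zs) \<Rightarrow> inv B V Zs) \<and>
      (case S k of (B, V, Zs) \<Rightarrow> case S (Suc k) of (B', V', Zs') \<Rightarrow> \<exists>W z. nxt B V Zs B' V' Zs' W z)" ..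
  define B where "B k = fst (S k)" for k
  define V where "V k = fst (snd (S k))" for k
  define Zs where "Zs k = snd (snd (S k))" for k
  have inv: "inv (B k) (V k) (Zs k)" for k
    using S [rule_format, of k] by (simp add: B_def V_def Zs_def split_beta)
  have "\<exists>W z. nxt (B k) (V k) (Zs k) (B (Suc k)) (V (Suc k)) (Zs (Suc k)) W z" for k
    using S [rule_format, of k] by (simp add: B_def V_def Zs_def split_beta)
  then obtain W z where nxt: "\<And>k. nxt (B k) (V k) (Zs k) (B (Suc k)) (V (Suc k)) (Zs (Suc k)) (W k) (z k)"
    by metis
  have "(\<Inter>k. B k i) \<noteq> {}" if "i \<in> J" for i
  proof (rule pseudocompact_space_Inter_nonempty)
    show "completely_regular_space (X i)" "pseudocompact_space (X i)"
      using creg pcomp that IJ by blast+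
    show "openin (X i) (B k i)" "B k i \<noteq> {}" "X i closure_of B (Suc k) i \<subseteq> B k i" for k
      using inv [of k] nxt [of k] that by (auto simp: inv_def opens_def nxt_def)
  qed
  then have "\<forall>i\<in>J. \<exists>b. \<forall>k. b \<in> B k i"
    by (auto simp: ex_in_conv [symmetric])
  from bchoice [OF this] obtain b where b: "\<And>i k. i \<in> J \<Longrightarrow> b i \<in> B k i"
    by blast
  \<comment> \<open>The common point of all boxes is fixed, so only the coordinates \<open>q\<close>
    and \<open>j\<close> remain to vary.\<close>
  define y where "y = (\<lambda>i. if i \<in> J then b i else a i)"
  have bX: "b i \<in> topspace (X i)" if "i \<in> J" for i
  proof -
    have "openin (X i) (B 0 i)"
      using inv [of 0] that by (simp add: inv_def opens_def)
    then show ?thesis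
      using b [OF that, of 0] openin_subset by blast
  qed
  then have yX: "y \<in> topspace XX"
    using a IJ by (auto simp: y_def PiE_iff extensional_def)
  have ybx: "y(q := x) \<in> bx (B k)" if "x \<in> topspace (X q)" for x k
    using upd_in_XX [OF yX m(3) that] b IJ by (auto simp: bx_def y_def)
  have WX: "x \<in> topspace (X q)" if "x \<in> W k" for x k
  proof -
    have "openin (X q) (W k)"
      using nxt [of k] by (simp add: nxt_def)
    then show ?thesis
      using that openin_subset by blast
  qed
  have Vdec: "V (Suc k) \<subseteq> V k" for k
    using nxt [of k] by (simp add: nxt_def)
  have Zs_mono: "Zs i \<subseteq> Zs k" if "i \<le> k" for i k
    by (rule lift_Suc_mono_le [OF _ that]) (use nxt in \<open>auto simp: nxt_def\<close>)
  \<comment> \<open>\<open>z i\<close> enters at index \<open>Suc i\<close>, so all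
    \<open>z i\<close> with \<open>i \<le> k\<close> are present at index
    \<open>Suc k\<close>.\<close>
  have zZs: "z i \<in> Zs (Suc k)" if "i \<le> k" for i k
    using Zs_mono [of "Suc i" "Suc k"] that nxt [of i] by (auto simp: nxt_def)
  show False
  proof (rule pseudocompact_no_half_graph [of "X q" "X j" "\<lambda>x v. f (y(q := x, j := v))" W V z l h])
    show "completely_regular_space (X q)" "pseudocompact_space (X q)"
      "completely_regular_space (X j)" "pseudocompact_space (X j)"
      using creg pcomp m jn by blast+
    show "continuous_map (X q) euclideanreal (\<lambda>x. f (y(q := x, j := v)))" if "v \<in> topspace (X j)" for v
      using sc [of m] \<Phi> upd_in_XX [OF yX jn(1) that] m jn
      by (simp add: sepcont_def f_def fun_upd_twist)
    show "continuous_map (X j) euclideanreal (\<lambda>v. f (y(q := x, j := v)))" if "x \<in> topspace (X q)" for x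
      using sc [of m] \<Phi> upd_in_XX [OF yX m(3) that] jn
      by (simp add: sepcont_def f_def)
    show "openin (X q) (W k)" "W k \<noteq> {}" "openin (X j) (V k)" "z k \<in> V k" for k
      using nxt [of k] inv [of k] by (auto simp: nxt_def inv_def)
    show "f (y(q := x, j := z i)) < l" if "i \<le> k" "x \<in> W k" for i k x
      using nxt [of k] ybx [OF WX [OF that(2)], of "Suc k"] zZs [OF that(1)] that(2) by (simp add: nxt_def)
    show "f (y(q := x, j := v)) > h" if "x \<in> W k" "v \<in> V (Suc k)" for k x v
      using nxt [of k] ybx [OF WX [OF that(1)], of "Suc k"] that by (simp add: nxt_def)
  qed (use Vdec lh in auto)
qed

section \<open>Double induction on stages and boxes\<close>

lemma sepcont_if_quasicont_singletons:
  assumes "m \<le> n" "\<And>k i. k \<le> m \<Longrightarrow> i \<in> {k<..n} \<Longrightarrow> quasicont k {i}" "k \<le> m"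
  shows "sepcont k"
  using assms(3)
proof (induction k rule: less_induct)
  case (less k)
  show ?case
  proof (rule sepcont_if_quasicont)
    show "sepcont l" if "l < k" for l
      using less that by simp
    show "quasicont k {i}" if "i \<in> {k<..n}" for i
      using assms(2) [OF less.prems that] .
  qed (use less.prems assms(1) in simp)
qed

text \<open>Outer induction on \<open>card I + m\<close>, inner induction on the stage with this sum
  fixed. In \<open>quasicont_step\<close>, \<open>Q1\<close> and \<open>Q2\<close> lower the sum by
  one, while \<open>Q3\<close> trades a stage for an additional side. Separate continuity of the
  earlier stages comes from singletons, whose sums are smaller.\<close>

lemma quasicont_if_subset:
  assumes "m \<le> n" "I \<subseteq> {m<..n}"
  shows "quasicont m I"
  using assms
proof (induction "card I + m" arbitrary: m I rule: less_induct)
  case outer: less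
  have "quasicont k I'" if "card I' + k = card I + m" "k \<le> n" "I' \<subseteq> {k<..n}" for k I'
    using that
  proof (induction k arbitrary: I')
    case 0
    then show ?case
      by (intro quasicont_0) auto
  next
    case (Suc k)
    show ?case
    proof (cases "I' = {}")
      case True
      then show ?thesis
        using quasicont_empty Suc.prems by simp
    next
      case False
      have fin: "finite I'"
        using Suc.prems finite_subset by blast
      have card: "card I' \<ge> 1"
        using False fin by (simp add: Suc_le_eq card_gt_0_iff)
      have sc: "sepcont l" if "l \<le> k" for l
      proof (rule sepcont_if_quasicont_singletons [OF _ _ that])
        fix l i assume "l \<le> k" "i \<in> {l<..n}"
        then show "quasicont l {i}"
          using card Suc.prems by (intro outer.hyps) auto
      qed (use Suc.prems in simp)
      have k: "Suc k \<notin> I'"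
        using Suc.prems by auto
      have Q1: "quasicont (Suc k) (I' - {j})" if "j \<in> I'" for j
      proof (rule outer.hyps)
        show "card (I' - {j}) + Suc k < card I + m"
          using that fin card Suc.prems(1) by (simp add: card_Diff_singleton)
      qed (use Suc.prems in auto)
      have Q2: "quasicont k (insert (Suc k) (I' - {j}))" if "j \<in> I'" for j
      proof (rule outer.hyps)
        show "card (insert (Suc k) (I' - {j})) + k < card I + m"
          using that fin card k Suc.prems(1) by (simp add: card_Diff_singleton)
      qed (use Suc.prems in auto)
      have Q3: "quasicont k (insert (Suc k) I')"
        using Suc.prems fin k by (intro Suc.IH) auto
      show ?thesis
        unfolding quasicont_def
      proof (intro allI impI)
        fix \<Phi> a U j
        assume *: "continuous_map XX euclideanreal \<Phi>" "a \<in> topspace XX"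
          "\<forall>i\<in>I'. openin (X i) (U i) \<and> a i \<in> U i" "iterlim p (Suc k) \<Phi> a > 0"
        \<comment> \<open>\<open>quasicont_step\<close> needs a chosen side in \<open>I'\<close>; if
          \<open>j\<close> is not one, any side will do.\<close>
        obtain i where i: "i \<in> I'" "j \<in> I' \<Longrightarrow> i = j"
          using False by blast
        have "\<exists>B. (\<forall>i\<in>I'. openin (X i) (B i) \<and> B i \<noteq> {} \<and> B i \<subseteq> U i) \<and> a i \<in> B i \<and>
            (\<forall>x\<in>free_box (Suc k) I' B a. iterlim p (Suc k) \<Phi> x > 0)"
          by (rule quasicont_step) (use * i Suc.prems sc Q1 Q2 Q3 in auto)
        then show "\<exists>B. (\<forall>i\<in>I'. openin (X i) (B i) \<and> B i \<noteq> {} \<and> B i \<subseteq> U i) \<and> (j \<in> I' \<longrightarrow> a j \<in> B j) \<and>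
            (\<forall>x\<in>free_box (Suc k) I' B a. iterlim p (Suc k) \<Phi> x > 0)"
          using i(2) by blast
      qed
    qed
  qed
  then show ?case
    using outer.prems by blast
qed

lemma sepcont_all: "m \<le> n \<Longrightarrow> sepcont m"
  by (rule sepcont_if_quasicont_singletons [OF _ _ order_refl]) (auto intro: quasicont_if_subset)

end

subsection \<open>Limits at points of the Stone--Cech compactification\<close>

text \<open>Pseudocompactness confines \<open>f\<close> to a compact interval, to which the
  universal property applies.\<close>

lemma stone_cech_extension_real:
  fixes f :: "'a \<Rightarrow> real"
  assumes "pseudocompact_space X" and f: "continuous_map X euclideanreal f"
  obtains H where "continuous_map (stone_cech X) euclideanreal H"
    "\<And>x. x \<in> topspace X \<Longrightarrow> H (stone_cech_embed X x) = f x"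
proof -
  obtain b where "\<forall>x\<in>topspace X. \<bar>f x\<bar> \<le> b"
    using assms by (auto simp: pseudocompact_space_def bounded_iff)
  then have "continuous_map X (top_of_set {-b..b}) f"
    using f by (auto simp: continuous_map_in_subtopology abs_le_iff)
  moreover have "compact_space (top_of_set {-b..b})" "Hausdorff_space (top_of_set {-b..b})"
    by (simp_all add: compact_space_subtopology Hausdorff_space_subtopology)
  ultimately obtain H where "continuous_map (stone_cech X) (top_of_set {-b..b}) H"
    "\<forall>x \<in> topspace X. H (stone_cech_embed X x) = f x"
    using stone_cech_extension by metis
  then show thesis
    by (auto simp: continuous_map_in_subtopology intro: that)
qed

text \<open>The trace on \<open>X\<close> of the neighbourhood filter of \<open>k\<close>. The
  principal part excludes arguments off the carrier, where the total function
  \<open>stone_cech_embed X\<close> still has values.\<close>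

definition stone_cech_filter :: "'a topology \<Rightarrow> (('a \<Rightarrow> real) \<Rightarrow> real) \<Rightarrow> 'a filter" where
  "stone_cech_filter X k =
     inf (filtercomap (stone_cech_embed X) (nhdsin (stone_cech X) k)) (principal (topspace X))"

lemma eventually_stone_cech_filter:
  assumes "k \<in> topspace (stone_cech X)"
  shows "eventually P (stone_cech_filter X k) \<longleftrightarrow>
    (\<exists>S. openin (stone_cech X) S \<and> k \<in> S \<and> (\<forall>x\<in>topspace X. stone_cech_embed X x \<in> S \<longrightarrow> P x))"
  using assms
  unfolding stone_cech_filter_def eventually_inf_principal eventually_filtercomap eventually_nhdsin
proof (intro iffI; elim exE conjE)
  fix Q assume "k \<notin> topspace (stone_cech X) \<or> (\<exists>S. openin (stone_cech X) S \<and> k \<in> S \<and> Ball S Q)"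
    and Q: "\<forall>x. Q (stone_cech_embed X x) \<longrightarrow> x \<in> topspace X \<longrightarrow> P x"
  then obtain S where "openin (stone_cech X) S" "k \<in> S" "Ball S Q"
    using assms by blast
  then show "\<exists>S. openin (stone_cech X) S \<and> k \<in> S \<and> (\<forall>x\<in>topspace X. stone_cech_embed X x \<in> S \<longrightarrow> P x)"
    using Q by (intro exI [of _ S]) blast
next
  fix S assume "openin (stone_cech X) S" "k \<in> S" "\<forall>x\<in>topspace X. stone_cech_embed X x \<in> S \<longrightarrow> P x"
  then show "\<exists>Q. (k \<notin> topspace (stone_cech X) \<or> (\<exists>S. openin (stone_cech X) S \<and> k \<in> S \<and> Ball S Q)) \<and>
      (\<forall>x. Q (stone_cech_embed X x) \<longrightarrow> x \<in> topspace X \<longrightarrow> P x)"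
    by (intro exI [of _ "\<lambda>u. u \<in> S"]) blast
qed

lemma stone_cech_filter_nonbot:
  assumes "k \<in> topspace (stone_cech X)"
  shows "stone_cech_filter X k \<noteq> bot"
proof
  assume "stone_cech_filter X k = bot"
  then obtain S where S: "openin (stone_cech X) S" "k \<in> S"
    "\<forall>x\<in>topspace X. stone_cech_embed X x \<notin> S"
    using eventually_stone_cech_filter [OF assms, of "\<lambda>_. False"] by auto
  have "k \<in> stone_cech X closure_of (stone_cech_embed X ` topspace X)"
    using assms by (simp add: dense_stone_cech_embed)
  then show False
    using S by (auto simp: in_closure_of)
qed

lemma tendsto_stone_cech_filter:
  fixes f :: "'a \<Rightarrow> real"
  assumes k: "k \<in> topspace (stone_cech X)" and H: "continuous_map (stone_cech X) euclideanreal H"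
    and eq: "\<And>x. x \<in> topspace X \<Longrightarrow> H (stone_cech_embed X x) = f x"
  shows "(f \<longlongrightarrow> H k) (stone_cech_filter X k)"
proof (rule topological_tendstoI)
  fix S :: "real set" assume "open S" "H k \<in> S"
  then show "eventually (\<lambda>x. f x \<in> S) (stone_cech_filter X k)"
    unfolding eventually_stone_cech_filter [OF k]
    using k eq openin_continuous_map_preimage [OF H, of S]
    by (intro exI [of _ "{u \<in> topspace (stone_cech X). H u \<in> S}"]) auto
qed

text \<open>Limits along these filters are values of the continuous extension. Continuity in
  \<open>k\<close> and the values at embedded points are both read off from this.\<close>

lemma Lim_stone_cech_filter:
  fixes f :: "'a \<Rightarrow> real"
  assumes "k \<in> topspace (stone_cech X)" "continuous_map (stone_cech X) euclideanreal H"
    "\<And>x. x \<in> topspace X \<Longrightarrow> H (stone_cech_embed X x) = f x"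
  shows "Lim (stone_cech_filter X k) f = H k"
  using tendsto_Lim [OF _ tendsto_stone_cech_filter [OF assms]] stone_cech_filter_nonbot [OF assms(1)]
  by simp

lemma converging_stone_cech_filter:
  assumes "pseudocompact_space X" "k \<in> topspace (stone_cech X)"
  shows "converging_filter X (stone_cech_filter X k)"
  unfolding converging_filter_def
proof (intro conjI allI impI)
  show "stone_cech_filter X k \<noteq> bot"
    by (rule stone_cech_filter_nonbot [OF assms(2)])
  show "eventually (\<lambda>x. x \<in> topspace X) (stone_cech_filter X k)"
    using assms(2) by (auto simp: eventually_stone_cech_filter)
  show "\<exists>l. (f \<longlongrightarrow> l) (stone_cech_filter X k)" if "continuous_map X euclideanreal f" for f :: "'a \<Rightarrow> real"
    using stone_cech_extension_real [OF assms(1) that] tendsto_stone_cech_filter [OF assms(2)] by metis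
qed

section \<open>The extension and its values\<close>

lemma stone_cech_embed_in_stone_cech:
  "x \<in> topspace X \<Longrightarrow> stone_cech_embed X x \<in> topspace (stone_cech X)"
  using image_subset_closure [of X] by (auto simp: topspace_stone_cech)

theorem theorem4:
  fixes n :: nat and X :: "nat \<Rightarrow> 'a topology" and \<Phi> :: "(nat \<Rightarrow> 'a) \<Rightarrow> real"
  assumes "n \<ge> 1"
    and "\<And>i. i \<in> {1..n} \<Longrightarrow> tychonoff_space (X i)"
    and "\<And>i. i \<in> {1..n} \<Longrightarrow> pseudocompact_space (X i)"
    and "continuous_map (product_topology X {1..n}) euclideanreal \<Phi>"
  shows "\<exists>\<Phi>' :: (nat \<Rightarrow> ('a \<Rightarrow> real) \<Rightarrow> real) \<Rightarrow> real.
           separately_continuous {1..n} (\<lambda>i. stone_cech (X i)) \<Phi>' \<and>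
           (\<forall>x \<in> (\<Pi>\<^sub>E i\<in>{1..n}. topspace (X i)).
              \<Phi>' (\<lambda>i\<in>{1..n}. stone_cech_embed (X i) (x i)) = \<Phi> x)"
proof -
  define F where "F k i = stone_cech_filter (X i) (k i)" for k :: "nat \<Rightarrow> ('a \<Rightarrow> real) \<Rightarrow> real" and i
  \<comment> \<open>After \<open>n\<close> limits every coordinate in the product has been
    overwritten, so \<open>z\<close> is only a placeholder.\<close>
  define z where "z = (\<lambda>i\<in>{1..n}. SOME t. t \<in> topspace (X i))"
  let ?XX = "product_topology X {1..n}"
  let ?K = "\<Pi>\<^sub>E i\<in>{1..n}. topspace (stone_cech (X i))"
  have creg: "completely_regular_space (X i)" if "i \<in> {1..n}" for i
    using assms(2) [OF that] by (simp add: tychonoff_space_def)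
  have loc: "iterated_limits n X (F k)" if "k \<in> ?K" for k
  proof
    show "converging_filter (X i) (F k i)" if "i \<in> {1..n}" for i
      using \<open>k \<in> ?K\<close> that assms(3) by (auto simp: F_def PiE_iff intro: converging_stone_cech_filter)
  qed (use creg assms(3) in auto)
  have cont: "continuous_map (X i) euclideanreal (\<lambda>t. iterlim (F k) m \<Phi> (x(i := t)))"
    if "k \<in> ?K" "m \<le> n" "x \<in> topspace ?XX" "i \<in> {m<..n}" for k m x i
    using iterated_limits.sepcont_all [OF loc [OF that(1)] that(2)] assms(4) that
    unfolding iterated_limits.sepcont_def [OF loc [OF that(1)]] by blast
  have upd: "x(i := t) \<in> topspace ?XX"
    if "x \<in> topspace ?XX" "i \<in> {1..n}" "t \<in> topspace (X i)" for x i t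
    using that by (auto simp: PiE_iff extensional_def)
  \<comment> \<open>If some \<open>X i\<close> is empty, so is its compactification; a given
    \<open>k\<close> therefore guarantees that all factors are nonempty.\<close>
  have zX: "z \<in> topspace ?XX" if "k \<in> ?K" for k
  proof -
    have "topspace (X i) \<noteq> {}" if "i \<in> {1..n}" for i
    proof -
      have "topspace (stone_cech (X i)) \<noteq> {}"
        using \<open>k \<in> ?K\<close> that by (metis PiE_mem empty_iff)
      then show ?thesis
        unfolding topspace_stone_cech by (metis closure_of_empty image_empty)
    qed
    then show ?thesis
      by (auto simp: z_def some_in_eq)
  qed
  \<comment> \<open>Induction starts at \<open>m = i\<close>: as a function of \<open>t\<close>, the
    limit along \<open>X i\<close> is the extension of the preceding stage to the compactification.
    Each later limit preserves continuity in \<open>t\<close> by \<open>continuous_map_Lim\<close>,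
    as \<open>stone_cech (X i)\<close> is compact.\<close>
  have sep: "continuous_map (stone_cech (X i)) euclideanreal (\<lambda>t. iterlim (F (k(i := t))) m \<Phi> x)"
    if k: "k \<in> ?K" and i: "i \<in> {1..n}" and "i \<le> m" "m \<le> n" "x \<in> topspace ?XX" for k i m x
    using that(3-5)
  proof (induction m arbitrary: x rule: dec_induct)
    case base
    obtain i' where i': "i = Suc i'"
      using i by (cases i) auto
    have "continuous_map (X i) euclideanreal (\<lambda>s. iterlim (F k) i' \<Phi> (x(i := s)))"
      using cont [OF k, of i' x i] base i i' by simp
    then obtain H where H: "continuous_map (stone_cech (X i)) euclideanreal H"
      "\<And>s. s \<in> topspace (X i) \<Longrightarrow> H (stone_cech_embed (X i) s) = iterlim (F k) i' \<Phi> (x(i := s))"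
      using stone_cech_extension_real [OF assms(3) [OF i]] by metis
    have "iterlim (F (k(i := t))) i' \<Phi> y = iterlim (F k) i' \<Phi> y" for t y
      by (rule iterlim_filter_cong) (use i' in \<open>auto simp: F_def\<close>)
    then have "iterlim (F (k(i := t))) i \<Phi> x = H t" if "t \<in> topspace (stone_cech (X i))" for t
      using Lim_stone_cech_filter [OF that H] i' by (simp add: F_def)
    then show ?case
      by (intro continuous_map_eq [OF H(1)]) (rule sym)
  next
    case (step m)
    let ?q = "Suc m"
    have q: "?q \<in> {1..n}" "?q \<noteq> i"
      using step by auto
    have kt: "k(i := t) \<in> ?K" if "t \<in> topspace (stone_cech (X i))" for t
      using k i that by (auto simp: PiE_iff extensional_def)
    have "continuous_map (stone_cech (X i)) euclideanreal
        (\<lambda>t. Lim (F k ?q) (\<lambda>s. iterlim (F (k(i := t))) m \<Phi> (x(?q := s))))"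
    proof (rule continuous_map_Lim)
      show "continuous_map (stone_cech (X i)) euclideanreal (\<lambda>t. iterlim (F (k(i := t))) m \<Phi> (x(?q := s)))"
        if "s \<in> topspace (X ?q)" for s
        using step.prems that by (intro step.IH upd q) auto
      show "continuous_map (X ?q) euclideanreal (\<lambda>s. iterlim (F (k(i := t))) m \<Phi> (x(?q := s)))"
        if "t \<in> topspace (stone_cech (X i))" for t
        using step.prems by (intro cont kt that) auto
      show "converging_filter (X ?q) (F k ?q)"
        using iterated_limits.filt [OF loc [OF k] q(1)] .
    qed (use compact_space_stone_cech creg assms(3) q in auto)
    moreover have "F (k(i := t)) ?q = F k ?q" for t
      using q by (simp add: F_def)
    ultimately show ?case
      by (simp only: iterlim.simps)
  qed
  \<comment> \<open>At an embedded point the extension returns the original value, so each limit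
    merely substitutes the coordinate of \<open>x\<close>.\<close>
  have val: "iterlim (F (\<lambda>i\<in>{1..n}. stone_cech_embed (X i) (x i))) m \<Phi> y = \<Phi> (\<lambda>i. if i \<in> {1..m} then x i else y i)"
    if "m \<le> n" "x \<in> topspace ?XX" "y \<in> topspace ?XX" for x y m
    using that(1,3)
  proof (induction m arbitrary: y)
    case (Suc m)
    let ?q = "Suc m"
    let ?k = "\<lambda>i\<in>{1..n}. stone_cech_embed (X i) (x i)"
    have q: "?q \<in> {1..n}" using Suc.prems by auto
    have x: "x i \<in> topspace (X i)" if "i \<in> {1..n}" for i
      using \<open>x \<in> topspace ?XX\<close> that by (auto simp: PiE_iff)
    have k: "?k \<in> ?K"
      using x by (auto intro: stone_cech_embed_in_stone_cech)
    have "continuous_map (X ?q) euclideanreal (\<lambda>s. iterlim (F ?k) m \<Phi> (y(?q := s)))"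
      using Suc.prems by (intro cont k) auto
    then obtain H where H: "continuous_map (stone_cech (X ?q)) euclideanreal H"
      "\<And>s. s \<in> topspace (X ?q) \<Longrightarrow> H (stone_cech_embed (X ?q) s) = iterlim (F ?k) m \<Phi> (y(?q := s))"
      using stone_cech_extension_real [OF assms(3) [OF q]] by blast
    have "iterlim (F ?k) ?q \<Phi> y = H (?k ?q)"
      using Lim_stone_cech_filter [OF PiE_mem [OF k q] H] by (simp only: iterlim.simps F_def)
    also have "\<dots> = iterlim (F ?k) m \<Phi> (y(?q := x ?q))"
      using H(2) x q by simp
    also have "\<dots> = \<Phi> (\<lambda>i. if i \<in> {1..m} then x i else (y(?q := x ?q)) i)"
      using Suc.prems q x by (intro Suc.IH upd) auto
    also have "(\<lambda>i. if i \<in> {1..m} then x i else (y(?q := x ?q)) i) = (\<lambda>i. if i \<in> {1..?q} then x i else y i)"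
      by (auto simp: fun_eq_iff)
    finally show ?case .
  qed simp
  show ?thesis
  proof (intro exI conjI ballI)
    show "separately_continuous {1..n} (\<lambda>i. stone_cech (X i)) (\<lambda>k. iterlim (F k) n \<Phi> z)"
      unfolding separately_continuous_def using sep zX by auto
    fix x assume x: "x \<in> (\<Pi>\<^sub>E i\<in>{1..n}. topspace (X i))"
    have k: "(\<lambda>i\<in>{1..n}. stone_cech_embed (X i) (x i)) \<in> ?K"
      using x by (auto intro: stone_cech_embed_in_stone_cech)
    have "iterlim (F (\<lambda>i\<in>{1..n}. stone_cech_embed (X i) (x i))) n \<Phi> z
        = \<Phi> (\<lambda>i. if i \<in> {1..n} then x i else z i)"
      using x by (intro val zX [OF k]) auto
    also have "(\<lambda>i. if i \<in> {1..n} then x i else z i) = x"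
      using x by (auto simp: fun_eq_iff z_def PiE_iff extensional_def)
    finally show "iterlim (F (\<lambda>i\<in>{1..n}. stone_cech_embed (X i) (x i))) n \<Phi> z = \<Phi> x" .
  qed
qed

end
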